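(* Let $R$ be a commutative ring, $(O,q_O)$ an octonion algebra over $R$ (a composition algebra of rank $8$), $n\ge1$, and $V=O\oplus H(R^n)$ with quadratic form $q(\alpha,v,w)=\alpha\overline{\alpha}+v\cdot w^{\intercal}$. Let $\phi:\mathrm{Cl}(V)\to M_{2^{n+1}}(\operatorname{End}_R(O))$ be the $R$-algebra homomorphism induced by $(\alpha,v,w)\mapsto\begin{pmatrix}0&Z'_n(\alpha,v,w)\\\overline{Z'_n(\alpha,v,w)}&0\end{pmatrix}$. Then $\phi$ is injective, and $\mathrm{Cl}(V)$ and $M_{2^{n+1}}(\operatorname{End}_R(O))$ have the same rank as free $R$-modules.
   Context: A composition algebra over $R$ is a (not necessarily associative) unital $R$-algebra $A$, free of finite rank, containing $R$ via $1\mapsto1$, with a non-degenerate quadratic form $q_A$ satisfying $q_A(xy)=q_A(x)q_A(y)$; it has an involution $\alpha\mapsto\overline{\alpha}$ with $\alpha\overline{\alpha}=\overline{\alpha}\alpha=q_A(\alpha)$. Non-degenerate means: $\langle x,y\rangle=q(x+y)-q(x)-q(y)=0$ for all $y$ implies $x=0$. For $\alpha\in O$, $L_\alpha\in\operatorname{End}_R(O)$ is left multiplication by $\alpha$. For $v=(a_1,\dots,a_n)$, $w=(b_1,\dots,b_n)$: $Z'_1(\alpha,v,w)=\begin{pmatrix}a_1&L_\alpha\\-L_{\overline{\alpha}}&b_1\end{pmatrix}$, $\overline{Z'_1}=\begin{pmatrix}b_1&-L_\alpha\\L_{\overline{\alpha}}&a_1\end{pmatrix}$, and for $i>1$, $Z'_i=\begin{pmatrix}a_i&Z'_{i-1}\\-\overline{Z'_{i-1}}&b_i\end{pmatrix}$,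 $\overline{Z'_i}=\begin{pmatrix}b_i&-Z'_{i-1}\\\overline{Z'_{i-1}}&a_i\end{pmatrix}$ (scalars denote scalar multiples of the identity). $\mathrm{Cl}(V)$ is the Clifford algebra of $(V,q)$. *)

theory Defs
  imports "HOL-Analysis.Finite_Cartesian_Product" "HOL-Library.Numeral_Type"
begin

text \<open>The octonion algebra O is modelled on the free module R^8 (type 'r^8);
  End_R(O) elements are functions 'r^8 => 'r^8 that are R-linear.\<close>

type_synonym 'r endo = "'r^8 \<Rightarrow> 'r^8"
type_synonym 'r bmat = "nat \<Rightarrow> nat \<Rightarrow> 'r endo"

definition rlinear :: "('r::comm_ring_1) endo \<Rightarrow> bool" where
  "rlinear f \<longleftrightarrow> (\<forall>x y. f (x + y) = f x + f y) \<and> (\<forall>c x. f (c *s x) = c *s f x)"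

definition polar :: "('r::comm_ring_1^8 \<Rightarrow> 'r) \<Rightarrow> 'r^8 \<Rightarrow> 'r^8 \<Rightarrow> 'r" where
  "polar q x y = q (x + y) - q x - q y"

definition quadratic_form :: "('r::comm_ring_1^8 \<Rightarrow> 'r) \<Rightarrow> bool" where
  "quadratic_form q \<longleftrightarrow> (\<forall>c x. q (c *s x) = c * c * q x) \<and>
     (\<forall>x y z. polar q (x + y) z = polar q x z + polar q y z) \<and>
     (\<forall>c x y. polar q (c *s x) y = c * polar q x y)"

definition nondegenerate :: "('r::comm_ring_1^8 \<Rightarrow> 'r) \<Rightarrow> bool" where
  "nondegenerate q \<longleftrightarrow> (\<forall>x. (\<forall>y. polar q x y = 0) \<longrightarrow> x = 0)"

definition bilinear_op :: "('r::comm_ring_1^8 \<Rightarrow> 'r^8 \<Rightarrow> 'r^8) \<Rightarrow> bool" where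
  "bilinear_op m \<longleftrightarrow> (\<forall>x. rlinear (m x)) \<and> (\<forall>y. rlinear (\<lambda>x. m x y))"

definition octonion_algebra :: "('r::comm_ring_1^8 \<Rightarrow> 'r^8 \<Rightarrow> 'r^8) \<Rightarrow> 'r^8 \<Rightarrow> ('r^8 \<Rightarrow> 'r) \<Rightarrow> bool" where
  "octonion_algebra mul e q \<longleftrightarrow> bilinear_op mul \<and> (\<forall>x. mul e x = x \<and> mul x e = x)
     \<and> (\<forall>c. c *s e = 0 \<longrightarrow> c = 0)
     \<and> quadratic_form q \<and> nondegenerate q \<and> (\<forall>x y. q (mul x y) = q x * q y)"

definition oconj :: "('r::comm_ring_1^8 \<Rightarrow> 'r) \<Rightarrow> 'r^8 \<Rightarrow> 'r^8 \<Rightarrow> 'r^8" where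
  "oconj q e x = polar q x e *s e - x"

definition ezero :: "('r::comm_ring_1) endo" where "ezero = (\<lambda>x. 0)"
definition escal :: "'r::comm_ring_1 \<Rightarrow> 'r endo" where "escal a = (\<lambda>x. a *s x)"

definition mat_zero :: "('r::comm_ring_1) bmat" where "mat_zero = (\<lambda>i j. ezero)"

definition mneg :: "('r::comm_ring_1) bmat \<Rightarrow> 'r bmat" where
  "mneg Z = (\<lambda>i j x. - Z i j x)"

definition block :: "nat \<Rightarrow> 'r::comm_ring_1 \<Rightarrow> 'r bmat \<Rightarrow> 'r bmat \<Rightarrow> 'r \<Rightarrow> 'r bmat" where
  "block m a B C d = (\<lambda>i j.
     if i < m \<and> j < m then (if i = j then escal a else ezero)
     else if i < m \<and> m \<le> j \<and> j < 2*m then B i (j - m)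
     else if m \<le> i \<and> i < 2*m \<and> j < m then C (i - m) j
     else if m \<le> i \<and> i < 2*m \<and> m \<le> j \<and> j < 2*m then (if i = j then escal d else ezero)
     else ezero)"

text \<open>Zpair k = (Z'_k, conj Z'_k); Z'_0 = L_alpha, conj Z'_0 = L_{conj alpha} (1x1),
  so that Z'_1 is as in the paper. The vectors v = (a_1,...,a_n), w = (b_1,...,b_n) are
  0-indexed: a_i = v (i-1), b_i = w (i-1).\<close>
fun Zpair :: "('r::comm_ring_1^8 \<Rightarrow> 'r^8 \<Rightarrow> 'r^8) \<Rightarrow> 'r^8 \<Rightarrow> ('r^8 \<Rightarrow> 'r)
    \<Rightarrow> 'r^8 \<Rightarrow> (nat \<Rightarrow> 'r) \<Rightarrow> (nat \<Rightarrow> 'r) \<Rightarrow> nat \<Rightarrow> 'r bmat \<times> 'r bmat" where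
  "Zpair mul e q \<alpha> v w 0 =
     ((\<lambda>i j. if i = 0 \<and> j = 0 then mul \<alpha> else ezero),
      (\<lambda>i j. if i = 0 \<and> j = 0 then mul (oconj q e \<alpha>) else ezero))"
| "Zpair mul e q \<alpha> v w (Suc k) =
     (let Z = fst (Zpair mul e q \<alpha> v w k); Zb = snd (Zpair mul e q \<alpha> v w k) in
      (block (2^k) (v k) Z (mneg Zb) (w k), block (2^k) (w k) (mneg Z) Zb (v k)))"

definition phi_gen :: "('r::comm_ring_1^8 \<Rightarrow> 'r^8 \<Rightarrow> 'r^8) \<Rightarrow> 'r^8 \<Rightarrow> ('r^8 \<Rightarrow> 'r)
    \<Rightarrow> nat \<Rightarrow> 'r^8 \<Rightarrow> (nat \<Rightarrow> 'r) \<Rightarrow> (nat \<Rightarrow> 'r) \<Rightarrow> 'r bmat" where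
  "phi_gen mul e q n \<alpha> v w =
     block (2^n) 0 (fst (Zpair mul e q \<alpha> v w n)) (snd (Zpair mul e q \<alpha> v w n)) 0"

definition mat_one :: "nat \<Rightarrow> ('r::comm_ring_1) bmat" where
  "mat_one m = (\<lambda>i j. if i < m \<and> i = j then id else ezero)"

definition mat_mult :: "nat \<Rightarrow> ('r::comm_ring_1) bmat \<Rightarrow> 'r bmat \<Rightarrow> 'r bmat" where
  "mat_mult m A B = (\<lambda>i j. if i < m \<and> j < m then (\<lambda>x. \<Sum>k<m. A i k (B k j x)) else ezero)"

definition mat_alg :: "nat \<Rightarrow> ('r::comm_ring_1) bmat set" where
  "mat_alg m = {A. \<forall>i j. if i < m \<and> j < m then rlinear (A i j) else A i j = ezero}"

section \<open>Tensor algebra T(V) as free algebra on a basis of V, and Cl(V) = T(V)/I\<close>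

text \<open>Basis of V = O + H(R^n): Inl k (k::8) is the k-th basis vector of O;
  Inr j for j < n is the j-th basis vector of the first copy of R^n, and
  Inr (n+j) for j < n that of the second copy.\<close>
definition cl_letters :: "nat \<Rightarrow> (8 + nat) set" where
  "cl_letters n = range Inl \<union> Inr ` {..<2*n}"

type_synonym ('l,'r) falg = "'l list \<Rightarrow> 'r"

definition free_alg :: "'l set \<Rightarrow> ('l, 'r::comm_ring_1) falg set" where
  "free_alg A = {p. finite {u. p u \<noteq> 0} \<and> (\<forall>u. p u \<noteq> 0 \<longrightarrow> set u \<subseteq> A)}"

definition fa_add :: "('l,'r::comm_ring_1) falg \<Rightarrow> ('l,'r) falg \<Rightarrow> ('l,'r) falg" where
  "fa_add p q = (\<lambda>u. p u + q u)"
definition fa_diff :: "('l,'r::comm_ring_1) falg \<Rightarrow> ('l,'r) falg \<Rightarrow> ('l,'r) falg" where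
  "fa_diff p q = (\<lambda>u. p u - q u)"
definition fa_smult :: "'r::comm_ring_1 \<Rightarrow> ('l,'r) falg \<Rightarrow> ('l,'r) falg" where
  "fa_smult c p = (\<lambda>u. c * p u)"
definition fa_one :: "('l,'r::comm_ring_1) falg" where
  "fa_one = (\<lambda>u. if u = [] then 1 else 0)"
definition fa_mult :: "('l,'r::comm_ring_1) falg \<Rightarrow> ('l,'r) falg \<Rightarrow> ('l,'r) falg" where
  "fa_mult p q = (\<lambda>u. \<Sum>k\<le>length u. p (take k u) * q (drop k u))"

inductive_set fa_ideal :: "'l set \<Rightarrow> ('l,'r::comm_ring_1) falg set \<Rightarrow> ('l,'r) falg set"
  for A S where
  gen: "s \<in> S \<Longrightarrow> s \<in> fa_ideal A S"
| zero: "(\<lambda>u. 0) \<in> fa_ideal A S"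
| add: "p \<in> fa_ideal A S \<Longrightarrow> q \<in> fa_ideal A S \<Longrightarrow> fa_add p q \<in> fa_ideal A S"
| lmul: "p \<in> fa_ideal A S \<Longrightarrow> a \<in> free_alg A \<Longrightarrow> fa_mult a p \<in> fa_ideal A S"
| rmul: "p \<in> fa_ideal A S \<Longrightarrow> a \<in> free_alg A \<Longrightarrow> fa_mult p a \<in> fa_ideal A S"

definition iota :: "nat \<Rightarrow> 'r::comm_ring_1^8 \<Rightarrow> (nat \<Rightarrow> 'r) \<Rightarrow> (nat \<Rightarrow> 'r) \<Rightarrow> (8 + nat, 'r) falg" where
  "iota n \<alpha> v w = (\<lambda>u. case u of
      [Inl k] \<Rightarrow> \<alpha> $ k
    | [Inr j] \<Rightarrow> (if j < n then v j else if j < 2*n then w (j - n) else 0)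
    | _ \<Rightarrow> 0)"

text \<open>Quadratic form on V: q(alpha,v,w) = alpha conj(alpha) + v . w^T.\<close>
definition qV :: "('r::comm_ring_1^8 \<Rightarrow> 'r) \<Rightarrow> nat \<Rightarrow> 'r^8 \<Rightarrow> (nat \<Rightarrow> 'r) \<Rightarrow> (nat \<Rightarrow> 'r) \<Rightarrow> 'r" where
  "qV q n \<alpha> v w = q \<alpha> + (\<Sum>i<n. v i * w i)"

definition cl_relations :: "('r::comm_ring_1^8 \<Rightarrow> 'r) \<Rightarrow> nat \<Rightarrow> (8 + nat, 'r) falg set" where
  "cl_relations q n = {fa_diff (fa_mult (iota n \<alpha> v w) (iota n \<alpha> v w)) (fa_smult (qV q n \<alpha> v w) fa_one)
                       | \<alpha> v w. True}"

definition cl_ideal :: "('r::comm_ring_1^8 \<Rightarrow> 'r) \<Rightarrow> nat \<Rightarrow> (8 + nat, 'r) falg set" where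
  "cl_ideal q n = fa_ideal (cl_letters n) (cl_relations q n)"

definition cl_gen :: "('r::comm_ring_1^8 \<Rightarrow> 'r^8 \<Rightarrow> 'r^8) \<Rightarrow> 'r^8 \<Rightarrow> ('r^8 \<Rightarrow> 'r) \<Rightarrow> nat
    \<Rightarrow> 8 + nat \<Rightarrow> 'r bmat" where
  "cl_gen mul e q n l = (case l of
      Inl k \<Rightarrow> phi_gen mul e q n (axis k 1) (\<lambda>i. 0) (\<lambda>i. 0)
    | Inr j \<Rightarrow> (if j < n then phi_gen mul e q n 0 (\<lambda>i. if i = j then 1 else 0) (\<lambda>i. 0)
               else phi_gen mul e q n 0 (\<lambda>i. 0) (\<lambda>i. if i = j - n then 1 else 0)))"

definition fa_eval :: "nat \<Rightarrow> ('l \<Rightarrow> ('r::comm_ring_1) bmat) \<Rightarrow> ('l,'r) falg \<Rightarrow> 'r bmat" where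
  "fa_eval m F p = (\<lambda>i j x. \<Sum>u\<in>{u. p u \<noteq> 0}.
      p u *s (foldr (mat_mult m) (map F u) (mat_one m)) i j x)"

definition quot_free_rank :: "'l set \<Rightarrow> ('l,'r::comm_ring_1) falg set \<Rightarrow> nat \<Rightarrow> bool" where
  "quot_free_rank A I N \<longleftrightarrow> (\<exists>b. (\<forall>k<N. b k \<in> free_alg A)
     \<and> (\<forall>p\<in>free_alg A. \<exists>c. fa_diff p (\<lambda>u. \<Sum>k<N. c k * b k u) \<in> I)
     \<and> (\<forall>c. (\<lambda>u. \<Sum>k<N. c k * b k u) \<in> I \<longrightarrow> (\<forall>k<N. c k = 0)))"

definition mat_free_rank :: "nat \<Rightarrow> nat \<Rightarrow> 'r::comm_ring_1 itself \<Rightarrow> bool" where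
  "mat_free_rank m N _ \<longleftrightarrow> (\<exists>B :: nat \<Rightarrow> 'r bmat. (\<forall>k<N. B k \<in> mat_alg m)
     \<and> (\<forall>A\<in>mat_alg m. \<exists>c. A = (\<lambda>i j x. \<Sum>k<N. c k *s B k i j x))
     \<and> (\<forall>c. (\<lambda>i j x. \<Sum>k<N. c k *s B k i j x) = mat_zero \<longrightarrow> (\<forall>k<N. c k = 0)))"

end

(* A polynomial p in the kernel is reduced modulo the Clifford relations to a combination
   r of the ordered words in a basis of V, so it suffices that the ordered words act
   linearly independently. The supercommutator with a vector x preserves the linear relations
   between operators (the grading diag(1,-1) exchanges even and odd words only up to sign) and
   acts on words as the contraction with the functional <x,->. Hence, by induction on the
   degree, all contractions of r vanish formally, and the nondegeneracy of <-,-> kills every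
   coefficient of r except that of the empty word, which vanishes because O is faithful.
   Both ranks are then 2^(8+2n). *)
theory Submission
  imports Defs "HOL-Library.Function_Algebras"
begin

text \<open>Over an arbitrary ring, nondegeneracy only says that x is determined by <x,->. So 2 need
  not be invertible, V need not have an orthogonal or a dual basis, the Clifford algebra need not be
  central simple, and comparing dimensions does not give injectivity. In particular the coordinate
  functional of a letter need not come from any vector: supercommutators do not reach a single
  contraction, only the combinations of contractions weighted by a row of the Gram matrix. The
  induction therefore runs over all coefficient families at once. It is applied to the combined
  coefficients, one family for each row, and only afterwards, at each word separately, does
  injectivity of the Gram matrix isolate the single contractions. The matrices enter only as linear
  operators that square to the form and are odd for the grading, on a module where scalars act
  faithfully. As O need not be associative, the squares rest on conj(x)(xy) = q(x)y, which follows
  from multiplicativity of q and nondegeneracy.\<close>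

lemmas fun_apply = plus_fun_apply zero_fun_apply minus_apply uminus_apply

text \<open>As simp rules these turn sums of functions into abstractions.\<close>
declare fun_apply [simp del]

section \<open>Free algebras and their quotients\<close>

lemma sum_fun_apply: "(\<Sum>a\<in>S. f a) x = (\<Sum>a\<in>S. f a x)"
  by (induction S rule: infinite_finite_induct) (auto simp: fun_apply)

lemma fa_add_eq: "fa_add p r = p + r"
  by (simp add: fa_add_def fun_eq_iff fun_apply)

lemma fa_diff_eq: "fa_diff p r = p - r"
  by (simp add: fa_diff_def fun_eq_iff fun_apply)

interpretation falg: module fa_smult
  by unfold_locales (auto simp: fa_smult_def fun_eq_iff fun_apply algebra_simps)

lemma fa_smult_apply [simp]: "fa_smult c p u = c * p u"
  by (simp add: fa_smult_def)

definition mon :: "'l list \<Rightarrow> ('l,'r::comm_ring_1) falg" where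
  "mon u = (\<lambda>v. if v = u then 1 else 0)"

lemma fa_one_mon: "fa_one = mon []"
  by (simp add: fa_one_def mon_def)

lemma fa_mult_add_left: "fa_mult (p + p') r = fa_mult p r + fa_mult p' r"
  by (simp add: fa_mult_def fun_eq_iff fun_apply algebra_simps sum.distrib)

lemma fa_mult_add_right: "fa_mult r (p + p') = fa_mult r p + fa_mult r p'"
  by (simp add: fa_mult_def fun_eq_iff fun_apply algebra_simps sum.distrib)

lemma fa_mult_smult_left: "fa_mult (fa_smult c p) r = fa_smult c (fa_mult p r)"
  by (simp add: fa_mult_def fun_eq_iff fun_apply sum_distrib_left algebra_simps)

lemma fa_mult_smult_right: "fa_mult r (fa_smult c p) = fa_smult c (fa_mult r p)"
  by (simp add: fa_mult_def fun_eq_iff fun_apply sum_distrib_left algebra_simps)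

lemma fa_mult_diff_left: "fa_mult (p - p') r = fa_mult p r - fa_mult p' r"
  by (simp add: fa_mult_def fun_eq_iff fun_apply algebra_simps sum_subtractf)

lemma fa_mult_diff_right: "fa_mult r (p - p') = fa_mult r p - fa_mult r p'"
  by (simp add: fa_mult_def fun_eq_iff fun_apply algebra_simps sum_subtractf)

lemma fa_mult_sum_right: "fa_mult r (\<Sum>a\<in>S. f a) = (\<Sum>a\<in>S. fa_mult r (f a))"
proof (induction S rule: infinite_finite_induct)
  case (insert x F)
  then show ?case by (simp add: fa_mult_add_right)
qed (simp_all add: fa_mult_def fun_eq_iff fun_apply)

lemma fa_mult_one_left: "fa_mult fa_one p = p"
proof
  fix u
  have "fa_mult fa_one p u = (\<Sum>k\<le>length u. if k = 0 then p u else 0)"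
    unfolding fa_mult_def fa_one_def by (intro sum.cong) auto
  then show "fa_mult fa_one p u = p u"
    by simp
qed

lemma fa_mult_letter:
  "fa_mult (mon [x]) p u = (case u of [] \<Rightarrow> 0 | y # v \<Rightarrow> if y = x then p v else 0)"
proof (cases u)
  case Nil
  then show ?thesis by (simp add: fa_mult_def mon_def)
next
  case (Cons y v)
  \<comment> \<open>A one-letter left factor selects the single cut after the first letter.\<close>
  have "fa_mult (mon [x]) p u = (\<Sum>k\<le>length u. if k = 1 then (if y = x then p v else 0) else 0)"
    unfolding fa_mult_def mon_def using Cons
    by (intro sum.cong) (auto simp: take_Cons split: nat.splits)
  also have "\<dots> = (if y = x then p v else 0)"
    using Cons by (subst sum.delta) auto
  finally show ?thesis
    using Cons by simp
qed

lemma fa_mult_letter_mon: "fa_mult (mon [x]) (mon u) = mon (x # u)"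
  unfolding fun_eq_iff fa_mult_letter by (auto simp: mon_def split: list.splits)

lemma fa_mult_mon: "fa_mult (mon u) (mon v) = (mon (u @ v) :: ('l,'r::comm_ring_1) falg)"
proof
  fix w
  have "(fa_mult (mon u) (mon v) :: ('l,'r) falg) w = (\<Sum>k\<le>length w. if k = length u \<and> w = u @ v then 1 else (0::'r))"
    unfolding fa_mult_def mon_def
  proof (rule sum.cong)
    fix k assume "k \<in> {..length w}"
    \<comment> \<open>The bound on \<open>k\<close> matters: beyond the end of \<open>w\<close> the
      prefix no longer determines the cut.\<close>
    then have "take k w = u \<and> drop k w = v \<longleftrightarrow> k = length u \<and> w = u @ v"
      by (metis append_eq_conv_conj atMost_iff length_take min_absorb2)
    then show "(if take k w = u then 1 else 0) * (if drop k w = v then 1 else 0)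
        = (if k = length u \<and> w = u @ v then 1 else (0::'r))"
      by (auto split: if_splits)
  qed simp
  also have "\<dots> = (mon (u @ v) :: ('l,'r) falg) w"
    by (auto simp: mon_def sum.neutral)
  finally show "fa_mult (mon u) (mon v) w = (mon (u @ v) :: ('l,'r) falg) w" .
qed

lemma falg_expand:
  assumes "finite S" "\<And>u. u \<notin> S \<Longrightarrow> p u = 0"
  shows "p = (\<Sum>u\<in>S. fa_smult (p u) (mon u))"
proof
  fix v
  have "(\<Sum>u\<in>S. fa_smult (p u) (mon u)) v = (\<Sum>u\<in>S. if u = v then p u else 0)"
    by (auto simp: sum_fun_apply mon_def intro!: sum.cong)
  then show "p v = (\<Sum>u\<in>S. fa_smult (p u) (mon u)) v"
    using assms by simp
qed

lemma mon_in_free_alg: "set u \<subseteq> A \<Longrightarrow> mon u \<in> free_alg A"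
  by (auto simp: free_alg_def mon_def)

lemma free_alg_add: "p \<in> free_alg A \<Longrightarrow> r \<in> free_alg A \<Longrightarrow> p + r \<in> free_alg A"
  unfolding free_alg_def
  by (auto simp: fun_apply intro: finite_subset[of _ "{u. p u \<noteq> 0} \<union> {u. r u \<noteq> 0}"])
    (metis add_0 subsetD)

lemma free_alg_smult: "p \<in> free_alg A \<Longrightarrow> fa_smult c p \<in> free_alg A"
  unfolding free_alg_def
  by (auto intro: finite_subset[of _ "{u. p u \<noteq> 0}"]) (metis mult_zero_right subsetD)

lemma free_alg_diff: "p \<in> free_alg A \<Longrightarrow> r \<in> free_alg A \<Longrightarrow> p - r \<in> free_alg A"
  using free_alg_add[of p A "fa_smult (-1) r"] free_alg_smult[of r A "-1"] by simp

text \<open>The support of a product consists of concatenations of words from the two supports,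
  which bounds both its size and its letters.\<close>

lemma free_alg_mult:
  assumes "p \<in> free_alg A" "r \<in> free_alg A"
  shows "fa_mult p r \<in> free_alg A"
proof -
  have *: "\<exists>s t. u = s @ t \<and> p s \<noteq> 0 \<and> r t \<noteq> 0" if "fa_mult p r u \<noteq> 0" for u
  proof -
    obtain k where "p (take k u) * r (drop k u) \<noteq> 0"
      using \<open>fa_mult p r u \<noteq> 0\<close> unfolding fa_mult_def by (meson sum.not_neutral_contains_not_neutral)
    then show ?thesis
      by (metis append_take_drop_id mult_zero_left mult_zero_right)
  qed
  then have "{u. fa_mult p r u \<noteq> 0} \<subseteq> (\<lambda>(s,t). s @ t) ` ({u. p u \<noteq> 0} \<times> {u. r u \<noteq> 0})"
    by auto
  moreover have "finite ({u. p u \<noteq> 0} \<times> {u. r u \<noteq> 0})"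
    using assms by (auto simp: free_alg_def)
  ultimately have "finite {u. fa_mult p r u \<noteq> 0}"
    by (meson finite_imageI finite_subset)
  moreover have "set u \<subseteq> A" if u: "fa_mult p r u \<noteq> 0" for u
  proof -
    from *[OF u] obtain s t where "u = s @ t" "p s \<noteq> 0" "r t \<noteq> 0"
      by blast
    with assms show ?thesis by (simp add: free_alg_def)
  qed
  ultimately show ?thesis
    by (simp add: free_alg_def)
qed

section \<open>Two-sided ideals of the free algebra\<close>

lemma fa_ideal_subset_free_alg:
  assumes "S \<subseteq> free_alg A"
  shows "fa_ideal A S \<subseteq> free_alg A"
proof
  fix p assume "p \<in> fa_ideal A S"
  then show "p \<in> free_alg A"
  proof induction
    case zero
    then show ?case by (simp add: free_alg_def)
  qed (use assms in \<open>auto simp: fa_add_eq free_alg_add free_alg_mult\<close>)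
qed

text \<open>The closure rules contain no scalars; a scalar enters as left multiplication by a
  multiple of the unit.\<close>

lemma fa_ideal_smult:
  assumes "p \<in> fa_ideal A S"
  shows "fa_smult c p \<in> fa_ideal A S"
proof -
  have "fa_mult (fa_smult c fa_one) p \<in> fa_ideal A S"
    using assms by (intro fa_ideal.lmul free_alg_smult) (simp_all add: fa_one_mon mon_in_free_alg)
  then show ?thesis
    by (simp add: fa_mult_smult_left fa_mult_one_left)
qed

lemma fa_ideal_add: "p \<in> fa_ideal A S \<Longrightarrow> r \<in> fa_ideal A S \<Longrightarrow> p + r \<in> fa_ideal A S"
  using fa_ideal.add[of p A S r] by (simp add: fa_add_eq)

lemma fa_ideal_diff: "p \<in> fa_ideal A S \<Longrightarrow> r \<in> fa_ideal A S \<Longrightarrow> p - r \<in> fa_ideal A S"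
  using fa_ideal_add[of p A S "fa_smult (-1) r"] fa_ideal_smult[of r A S "-1"] by simp

lemma fa_ideal_zero: "0 \<in> fa_ideal A S"
  using fa_ideal.zero by (simp add: zero_fun_def)

section \<open>Normal forms modulo the Clifford relations\<close>

text \<open>The elements congruent modulo \<open>I\<close> to a combination of words in
  \<open>S\<close>. For the finite sets of ordered words used below, vanishing off \<open>S\<close>
  already makes \<open>r\<close> finitely supported.\<close>

definition clred :: "('l,'r::comm_ring_1) falg set \<Rightarrow> 'l list set \<Rightarrow> ('l,'r) falg set" where
  "clred I S = {p. \<exists>r. (\<forall>u. u \<notin> S \<longrightarrow> r u = 0) \<and> p - r \<in> I}"

lemma clred_mono: "S \<subseteq> T \<Longrightarrow> clred I S \<subseteq> clred I T"
  unfolding clred_def by blast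

lemma clred_add:
  assumes "p \<in> clred (fa_ideal A R) S" "p' \<in> clred (fa_ideal A R) S"
  shows "p + p' \<in> clred (fa_ideal A R) S"
proof -
  from assms obtain r r' where "\<forall>u. u \<notin> S \<longrightarrow> r u = 0" "p - r \<in> fa_ideal A R"
    "\<forall>u. u \<notin> S \<longrightarrow> r' u = 0" "p' - r' \<in> fa_ideal A R"
    unfolding clred_def by blast
  moreover from this have "p + p' - (r + r') \<in> fa_ideal A R"
    using fa_ideal_add[of "p - r" A R "p' - r'"] by (simp add: algebra_simps)
  ultimately show ?thesis
    unfolding clred_def by (intro CollectI exI[of _ "r + r'"]) (auto simp: fun_apply)
qed

lemma clred_smult:
  assumes "p \<in> clred (fa_ideal A R) S"
  shows "fa_smult c p \<in> clred (fa_ideal A R) S"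
proof -
  from assms obtain r where "\<forall>u. u \<notin> S \<longrightarrow> r u = 0" "p - r \<in> fa_ideal A R"
    unfolding clred_def by blast
  moreover have "fa_smult c p - fa_smult c r = fa_smult c (p - r)"
    by (simp add: falg.scale_right_diff_distrib)
  ultimately show ?thesis
    unfolding clred_def using fa_ideal_smult
    by (intro CollectI exI[of _ "fa_smult c r"]) auto
qed

lemma clred_diff:
  "p \<in> clred (fa_ideal A R) S \<Longrightarrow> p' \<in> clred (fa_ideal A R) S \<Longrightarrow> p - p' \<in> clred (fa_ideal A R) S"
  using clred_add[of p A R S "fa_smult (-1) p'"] clred_smult[of p' A R S "-1"] by simp

lemma clred_ideal: "p \<in> fa_ideal A R \<Longrightarrow> p \<in> clred (fa_ideal A R) S"
  unfolding clred_def by (intro CollectI exI[of _ 0]) (simp add: fun_apply)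

lemma clred_sum:
  "(\<And>a. a \<in> T \<Longrightarrow> f a \<in> clred (fa_ideal A R) S) \<Longrightarrow> (\<Sum>a\<in>T. f a) \<in> clred (fa_ideal A R) S"
  by (induction T rule: infinite_finite_induct) (simp_all add: clred_add clred_ideal fa_ideal_zero)

lemma clred_mon: "u \<in> S \<Longrightarrow> mon u \<in> clred (fa_ideal A R) S"
  unfolding clred_def by (intro CollectI exI[of _ "mon u"]) (auto simp: fa_ideal_zero mon_def)

text \<open>For distinct \<open>ls\<close> these are the products of basis vectors over subsets, in
  increasing order: the usual candidate for a basis of a Clifford algebra.\<close>

definition ordered_words :: "'l list \<Rightarrow> 'l list set" where
  "ordered_words ls = set (subseqs ls)"

lemma ordered_words_Nil [simp]: "ordered_words [] = {[]}"
  by (simp add: ordered_words_def)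

lemma ordered_words_Cons:
  "ordered_words (x # xs) = (#) x ` ordered_words xs \<union> ordered_words xs"
  by (simp add: ordered_words_def Let_def)

lemma finite_ordered_words [simp]: "finite (ordered_words ls)"
  by (simp add: ordered_words_def)

lemma Nil_in_ordered_words [simp]: "[] \<in> ordered_words ls"
  by (induction ls) (auto simp: ordered_words_Cons)

lemma set_ordered_word: "u \<in> ordered_words ls \<Longrightarrow> set u \<subseteq> set ls"
  using subseqs_powset[of ls] unfolding ordered_words_def by blast

lemma card_ordered_words: "distinct ls \<Longrightarrow> card (ordered_words ls) = 2 ^ length ls"
  unfolding ordered_words_def
  using distinct_card[of "subseqs ls"] distinct_set_subseqs[of ls] length_subseqs[of ls]
  by (simp add: distinct_map)

lemma sum_ordered_words_Cons:
  assumes "x \<notin> set xs"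
  shows "(\<Sum>u\<in>ordered_words (x # xs). f u)
    = (\<Sum>u\<in>ordered_words xs. f (x # u)) + (\<Sum>u\<in>ordered_words xs. f u)"
proof -
  have "(#) x ` ordered_words xs \<inter> ordered_words xs = {}"
    using assms set_ordered_word by (metis (no_types, opaque_lifting) Int_emptyI image_iff list.set_intros(1) subsetD)
  then have "sum f (ordered_words (x # xs))
      = sum f ((#) x ` ordered_words xs) + sum f (ordered_words xs)"
    unfolding ordered_words_Cons by (rule sum.union_disjoint[rotated 2]) auto
  then show ?thesis
    by (simp add: sum.reindex)
qed

lemma clred_letter_mult:
  assumes "p \<in> clred (fa_ideal A R) (ordered_words xs)" "x \<in> A"
  shows "fa_mult (mon [x]) p \<in> clred (fa_ideal A R) (ordered_words (x # xs))"
proof -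
  from assms obtain r where r: "\<forall>u. u \<notin> ordered_words xs \<longrightarrow> r u = 0" "p - r \<in> fa_ideal A R"
    unfolding clred_def by blast
  have "fa_mult (mon [x]) (p - r) \<in> fa_ideal A R"
    using r(2) assms(2) by (intro fa_ideal.lmul) (auto simp: mon_in_free_alg)
  moreover have "fa_mult (mon [x]) r u = 0" if "u \<notin> ordered_words (x # xs)" for u
    using that r(1) by (auto simp: fa_mult_letter ordered_words_Cons split: list.splits)
  ultimately show ?thesis
    unfolding clred_def by (auto simp: fa_mult_diff_right)
qed

section \<open>Straightening of words by the relations between letters\<close>

context
  fixes A :: "'l set" and R :: "('l,'r::comm_ring_1) falg set" and Q :: "'l \<Rightarrow> 'r"
    and b :: "'l \<Rightarrow> 'l \<Rightarrow> 'r"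
  assumes square: "\<And>k. k \<in> A \<Longrightarrow> mon [k,k] - fa_smult (Q k) (mon []) \<in> fa_ideal A R"
    and anticomm: "\<And>k l. k \<in> A \<Longrightarrow> l \<in> A \<Longrightarrow>
      mon [k,l] + mon [l,k] - fa_smult (b k l) (mon []) \<in> fa_ideal A R"
begin

text \<open>Inserting a letter terminates by induction on the ordering list. If \<open>k\<close>
  comes after the leading \<open>x\<close>, then modulo the ideal k x v = b(k,x) v - x k v. Here k v
  involves only the later letters, so the induction hypothesis straightens it, and putting
  \<open>x\<close> back in front keeps the result ordered. For k = x the square relation deletes
  both letters.\<close>

lemma clred_Cons_ordered_word:
  assumes "set ls \<subseteq> A" "k \<in> set ls" "u \<in> ordered_words ls"
  shows "mon (k # u) \<in> clred (fa_ideal A R) (ordered_words ls)"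
  using assms
proof (induction ls arbitrary: k u)
  case Nil
  then show ?case by simp
next
  case (Cons x xs)
  let ?I = "fa_ideal A R"
  have sub: "clred ?I (ordered_words xs) \<subseteq> clred ?I (ordered_words (x # xs))"
    by (rule clred_mono) (auto simp: ordered_words_Cons)
  consider (tail) "u \<in> ordered_words xs" | (head) v where "u = x # v" "v \<in> ordered_words xs"
    using Cons.prems(3) by (auto simp: ordered_words_Cons)
  then show ?case
  proof cases
    case tail
    show ?thesis
    proof (cases "k = x")
      case True
      with tail show ?thesis by (intro clred_mon) (auto simp: ordered_words_Cons)
    next
      case False
      with tail Cons show ?thesis using sub by auto
    qed
  next
    case head
    have v: "mon v \<in> free_alg A" "mon v \<in> clred ?I (ordered_words (x # xs))"
      using Cons.prems(1) set_ordered_word[OF head(2)] head(2)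
      by (auto intro!: mon_in_free_alg clred_mon simp: ordered_words_Cons)
    show ?thesis
    proof (cases "k \<in> set xs")
      case False
      then have "k = x" using Cons.prems by auto
      have "fa_mult (mon [x,x] - fa_smult (Q x) (mon [])) (mon v) \<in> ?I"
        using Cons.prems(1) v by (intro fa_ideal.rmul square) auto
      then have "mon (x # x # v) - fa_smult (Q x) (mon v) \<in> ?I"
        by (simp add: fa_mult_diff_left fa_mult_smult_left fa_mult_mon)
      then have "(mon (x # x # v) - fa_smult (Q x) (mon v)) + fa_smult (Q x) (mon v)
          \<in> clred ?I (ordered_words (x # xs))"
        using v by (intro clred_add clred_smult) (simp_all add: clred_ideal)
      then show ?thesis
        using head \<open>k = x\<close> by simp
    next
      case True
      have "fa_mult (mon [k,x] + mon [x,k] - fa_smult (b k x) (mon [])) (mon v) \<in> ?I"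
        using Cons.prems(1,2) v by (intro fa_ideal.rmul anticomm) auto
      then have I: "mon (k # x # v) + mon (x # k # v) - fa_smult (b k x) (mon v) \<in> ?I"
        by (simp add: fa_mult_diff_left fa_mult_add_left fa_mult_smult_left fa_mult_mon)
      have "fa_mult (mon [x]) (mon (k # v)) \<in> clred ?I (ordered_words (x # xs))"
        using Cons.prems True head by (intro clred_letter_mult Cons.IH) auto
      then have "(mon (k # x # v) + mon (x # k # v) - fa_smult (b k x) (mon v))
          + fa_smult (b k x) (mon v) - mon (x # k # v) \<in> clred ?I (ordered_words (x # xs))"
        unfolding fa_mult_letter_mon by (intro clred_diff[OF clred_add[OF clred_ideal[OF I] clred_smult[OF v(2)]]])
      then show ?thesis
        using head by simp
    qed
  qed
qed

text \<open>A word is straightened from its right end: its tail is replaced by a combination of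
  ordered words, and the first letter is then inserted into each of them.\<close>

lemma clred_free_alg:
  assumes "p \<in> free_alg A" "set ls = A"
  shows "p \<in> clred (fa_ideal A R) (ordered_words ls)"
proof -
  let ?I = "fa_ideal A R" and ?S = "ordered_words ls"
  have word: "mon u \<in> clred ?I ?S" if "set u \<subseteq> A" for u
    using that
  proof (induction u)
    case Nil
    then show ?case by (simp add: clred_mon)
  next
    case (Cons k u)
    then obtain r where r: "\<forall>v. v \<notin> ?S \<longrightarrow> r v = 0" "mon u - r \<in> ?I"
      unfolding clred_def by auto
    have "fa_mult (mon [k]) (mon u - r) \<in> ?I"
      using r Cons.prems by (intro fa_ideal.lmul) (auto simp: mon_in_free_alg)
    moreover have "fa_mult (mon [k]) r = (\<Sum>v\<in>?S. fa_smult (r v) (mon (k # v)))"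
      by (subst falg_expand[of ?S r])
        (use r in \<open>auto simp: fa_mult_sum_right fa_mult_smult_right fa_mult_letter_mon\<close>)
    moreover have "(\<Sum>v\<in>?S. fa_smult (r v) (mon (k # v))) \<in> clred ?I ?S"
      using Cons.prems assms(2) by (intro clred_sum clred_smult clred_Cons_ordered_word) auto
    ultimately have "fa_mult (mon [k]) (mon u - r) + fa_mult (mon [k]) r \<in> clred ?I ?S"
      by (intro clred_add) (simp_all add: clred_ideal)
    then show ?case
      by (simp add: fa_mult_letter_mon fa_mult_diff_right)
  qed
  have "p = (\<Sum>u\<in>{u. p u \<noteq> 0}. fa_smult (p u) (mon u))"
    using assms by (intro falg_expand) (auto simp: free_alg_def)
  moreover have "(\<Sum>u\<in>{u. p u \<noteq> 0}. fa_smult (p u) (mon u)) \<in> clred ?I ?S"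
    using assms by (intro clred_sum clred_smult word) (auto simp: free_alg_def)
  ultimately show ?thesis
    by simp
qed

end

section \<open>Operator representations of the Clifford relations\<close>

text \<open>One linear operator for each letter; the universal property of the free algebra turns
  this into an action of the whole algebra, namely \<open>ev\<close>.\<close>

locale word_action = module scale
  for scale :: "'r::comm_ring_1 \<Rightarrow> 'w::ab_group_add \<Rightarrow> 'w" +
  fixes X :: "'l \<Rightarrow> 'w \<Rightarrow> 'w"
  assumes X_add: "X l (x + y) = X l x + X l y"
    and X_scale: "X l (scale c x) = scale c (X l x)"
begin

lemma additive_X: "additive (X l)"
  by (simp add: additive_def X_add)

lemmas X_zero = additive.zero[OF additive_X]
lemmas X_diff = additive.diff[OF additive_X]
lemmas X_sum = additive.sum[OF additive_X]

abbreviation op :: "'l list \<Rightarrow> 'w \<Rightarrow> 'w" where "op u w \<equiv> foldr X u w"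

definition ev :: "('l,'r) falg \<Rightarrow> 'w \<Rightarrow> 'w" where
  "ev p w = (\<Sum>u\<in>{u. p u \<noteq> 0}. scale (p u) (op u w))"

lemma op_add: "op u (x + y) = op u x + op u y"
  by (induction u) (auto simp: X_add)

lemma op_scale: "op u (scale c x) = scale c (op u x)"
  by (induction u) (auto simp: X_scale)

lemma op_sum: "op u (\<Sum>a\<in>S. f a) = (\<Sum>a\<in>S. op u (f a))"
  by (rule additive.sum) (simp add: additive_def op_add)

text \<open>Supports shrink under cancellation, so sums with different supports are compared over a
  common finite superset.\<close>

lemma ev_superset:
  assumes "finite S" "\<And>u. u \<notin> S \<Longrightarrow> p u = 0"
  shows "ev p w = (\<Sum>u\<in>S. scale (p u) (op u w))"
  unfolding ev_def using assms by (intro sum.mono_neutral_left) auto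

lemma ev_zero: "ev 0 w = 0"
  by (simp add: ev_def fun_apply)

lemma ev_mon: "ev (mon u) w = op u w"
  by (subst ev_superset[of "{u}"]) (auto simp: mon_def)

lemma ev_add:
  assumes "p \<in> free_alg A" "r \<in> free_alg A"
  shows "ev (p + r) w = ev p w + ev r w"
proof -
  let ?S = "{u. p u \<noteq> 0} \<union> {u. r u \<noteq> 0}"
  have S: "finite ?S" using assms by (simp add: free_alg_def)
  have "ev (p + r) w = (\<Sum>u\<in>?S. scale ((p + r) u) (op u w))"
    "ev p w = (\<Sum>u\<in>?S. scale (p u) (op u w))" "ev r w = (\<Sum>u\<in>?S. scale (r u) (op u w))"
    by (rule ev_superset[OF S], simp add: fun_apply)+
  then show ?thesis
    by (simp add: fun_apply scale_left_distrib sum.distrib)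
qed

lemma ev_smult:
  assumes "p \<in> free_alg A"
  shows "ev (fa_smult c p) w = scale c (ev p w)"
proof -
  let ?S = "{u. p u \<noteq> 0}"
  have S: "finite ?S" using assms by (simp add: free_alg_def)
  have "ev (fa_smult c p) w = (\<Sum>u\<in>?S. scale (fa_smult c p u) (op u w))"
    by (rule ev_superset[OF S]) simp
  then show ?thesis
    by (simp add: ev_def scale_sum_right)
qed

lemma ev_diff:
  assumes "p \<in> free_alg A" "r \<in> free_alg A"
  shows "ev (p - r) w = ev p w - ev r w"
  using ev_add[OF assms(1) free_alg_smult[OF assms(2), of "-1"]] ev_smult[OF assms(2), of "-1"]
  by simp

text \<open>The double sum over pairs of words is regrouped along the fibres of concatenation; the
  fibre over \<open>u\<close> adds up to the coefficient of the product at \<open>u\<close>.\<close>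

lemma ev_mult:
  assumes "p \<in> free_alg A" "r \<in> free_alg A"
  shows "ev (fa_mult p r) w = ev p (ev r w)"
proof -
  define P T where "P = {s. p s \<noteq> 0}" and "T = {t. r t \<noteq> 0}"
  define U where "U = (\<lambda>(s,t). s @ t) ` (P \<times> T)"
  have fin: "finite P" "finite T" using assms by (auto simp: P_def T_def free_alg_def)
  have coeff: "fa_mult p r u = (\<Sum>(s,t)\<in>{z \<in> P \<times> T. (case z of (s,t) \<Rightarrow> s @ t) = u}. p s * r t)" for u
  proof -
    \<comment> \<open>Every factorisation of \<open>u\<close> is a cut of \<open>u\<close>; the cuts
      outside the two supports contribute zero.\<close>
    have "(\<Sum>(s,t)\<in>{z \<in> P \<times> T. (case z of (s,t) \<Rightarrow> s @ t) = u}. p s * r t)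
      = (\<Sum>(s,t)\<in>(\<lambda>k. (take k u, drop k u)) ` {..length u}. p s * r t)"
    proof (rule sum.mono_neutral_left)
      show "{z \<in> P \<times> T. (case z of (s,t) \<Rightarrow> s @ t) = u} \<subseteq> (\<lambda>k. (take k u, drop k u)) ` {..length u}"
      proof
        fix z assume "z \<in> {z \<in> P \<times> T. (case z of (s,t) \<Rightarrow> s @ t) = u}"
        then obtain s t where "z = (s,t)" "u = s @ t" by auto
        then show "z \<in> (\<lambda>k. (take k u, drop k u)) ` {..length u}"
          by (intro image_eqI[of _ _ "length s"]) auto
      qed
    qed (auto simp: P_def T_def)
    also have "\<dots> = (\<Sum>k\<le>length u. p (take k u) * r (drop k u))"
    proof (subst sum.reindex)
      show "inj_on (\<lambda>k. (take k u, drop k u)) {..length u}"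
        by (rule inj_onI) (metis Pair_inject atMost_iff length_take min_absorb2)
    qed simp
    finally show ?thesis by (simp add: fa_mult_def)
  qed
  have out: "fa_mult p r u = 0" if "u \<notin> U" for u
  proof -
    have "{z \<in> P \<times> T. (case z of (s,t) \<Rightarrow> s @ t) = u} = {}"
      using that unfolding U_def by auto
    then show ?thesis unfolding coeff by (simp only: sum.empty)
  qed
  have "ev (fa_mult p r) w = (\<Sum>u\<in>U. scale (fa_mult p r u) (op u w))"
    using fin out by (intro ev_superset) (auto simp: U_def)
  also have "\<dots> = (\<Sum>u\<in>U. \<Sum>z\<in>{z \<in> P \<times> T. (case z of (s,t) \<Rightarrow> s @ t) = u}.
      case z of (s,t) \<Rightarrow> scale (p s * r t) (op (s @ t) w))"
    unfolding coeff scale_sum_left by (intro sum.cong) auto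
  also have "\<dots> = (\<Sum>z\<in>P \<times> T. case z of (s,t) \<Rightarrow> scale (p s * r t) (op (s @ t) w))"
    using fin by (intro sum.group) (auto simp: U_def)
  also have "\<dots> = (\<Sum>s\<in>P. \<Sum>t\<in>T. scale (p s) (scale (r t) (op s (op t w))))"
    by (simp add: sum.cartesian_product)
  also have "\<dots> = ev p (ev r w)"
    by (simp add: ev_def P_def[symmetric] T_def[symmetric] op_sum op_scale scale_sum_right)
  finally show ?thesis .
qed

end

text \<open>Coefficients of the partial contraction of \<open>\<Sum>u. c u \<cdot> u\<close> by the dual of the letter \<open>l\<close>,
  with the signs hidden in the recursion over the ordered list of letters.\<close>

fun contract :: "'l list \<Rightarrow> 'l \<Rightarrow> ('l list \<Rightarrow> 'r::comm_ring_1) \<Rightarrow> 'l list \<Rightarrow> 'r" where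
  "contract [] l c u = 0"
| "contract (x # xs) l c u =
    (if u \<noteq> [] \<and> hd u = x then - contract xs l (\<lambda>t. c (x # t)) (tl u)
     else if l = x then c (x # u) else contract xs l c u)"

lemma contract_outside: "l \<notin> set ls \<Longrightarrow> contract ls l c u = 0"
  by (induction ls arbitrary: c u) auto

text \<open>A contraction removes one letter, so a degree bound on the coefficients drops by one.
  This drives the induction on the degree.\<close>

lemma contract_degree:
  "(\<And>u. length u \<ge> Suc r \<Longrightarrow> c u = 0) \<Longrightarrow> length u \<ge> r \<Longrightarrow> contract ls l c u = 0"
proof (induction ls arbitrary: c u r)
  case (Cons x xs)
  show ?case
  proof (cases "u \<noteq> [] \<and> hd u = x")
    case True
    then obtain v where v: "u = x # v" by (cases u) auto
    \<comment> \<open>Fixing the first letter \<open>x\<close> lowers the bound once more. For r = 0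
      truncated subtraction leaves it at 0, which the hypothesis on \<open>c\<close> also
      covers.\<close>
    have "contract xs l (\<lambda>t. c (x # t)) v = 0"
      using Cons.prems v by (intro Cons.IH[of "r - 1"]) auto
    then show ?thesis using v by simp
  next
    case False
    then show ?thesis using Cons by auto
  qed
qed simp

lemma hd_ordered_word: "u \<in> ordered_words xs \<Longrightarrow> x \<notin> set xs \<Longrightarrow> \<not> (u \<noteq> [] \<and> hd u = x)"
  using set_ordered_word by (metis hd_in_set subsetD)

text \<open>Contracting by the first letter of a word and reading off at its tail returns the
  coefficient of the word, with sign plus.\<close>

lemma contract_eq_0_imp:
  assumes "distinct ls" "\<And>l u. l \<in> set ls \<Longrightarrow> u \<in> ordered_words ls \<Longrightarrow> contract ls l c u = 0"
    and "u \<in> ordered_words ls" "u \<noteq> []"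
  shows "c u = 0"
  using assms
proof (induction ls arbitrary: u)
  case (Cons x xs)
  have x: "x \<notin> set xs" using Cons.prems(1) by simp
  from Cons.prems(3) consider (tail) "u \<in> ordered_words xs" | (head) v where "u = x # v" "v \<in> ordered_words xs"
    by (auto simp: ordered_words_Cons)
  then show ?case
  proof cases
    case tail
    have "contract xs l c u = 0" if lu: "l \<in> set xs" "u \<in> ordered_words xs" for l u
      using Cons.prems(2)[of l u] lu x hd_ordered_word[OF lu(2) x]
      by (auto simp: ordered_words_Cons split: if_splits)
    then show ?thesis
      using Cons.IH[OF _ _ tail] Cons.prems by simp
  next
    case head
    then show ?thesis
      using Cons.prems(2)[of x v] hd_ordered_word[OF head(2) x]
      by (auto simp: ordered_words_Cons split: if_splits)
  qed
qed simp

definition letter_vec :: "'l \<Rightarrow> 'l \<Rightarrow> 'r::comm_ring_1" where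
  "letter_vec l = (\<lambda>k. if k = l then 1 else 0)"

text \<open>The vector with coordinates \<open>x\<close> as an element of degree one. Coordinates
  outside \<open>A\<close> are cut off, so every function denotes a vector.\<close>

definition letter_comb :: "'l set \<Rightarrow> ('l \<Rightarrow> 'r::comm_ring_1) \<Rightarrow> ('l,'r) falg" where
  "letter_comb A x = (\<lambda>u. case u of [l] \<Rightarrow> if l \<in> A then x l else 0 | _ \<Rightarrow> 0)"

definition cliff_rel :: "'l set \<Rightarrow> (('l \<Rightarrow> 'r::comm_ring_1) \<Rightarrow> 'r) \<Rightarrow> ('l \<Rightarrow> 'r) \<Rightarrow> ('l,'r) falg" where
  "cliff_rel A Q x = fa_diff (fa_mult (letter_comb A x) (letter_comb A x)) (fa_smult (Q x) fa_one)"

lemma letter_comb_in_free_alg: "letter_comb A x \<in> free_alg A" if "finite A"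
proof -
  have "{u. letter_comb A x u \<noteq> 0} \<subseteq> (\<lambda>l. [l]) ` A"
  proof
    fix u assume "u \<in> {u. letter_comb A x u \<noteq> 0}"
    then show "u \<in> (\<lambda>l. [l]) ` A"
      by (cases u rule: remdups_adj.cases) (auto simp: letter_comb_def split: if_splits)
  qed
  then show ?thesis
    unfolding free_alg_def using that by (auto intro: finite_subset[OF _ finite_imageI])
qed

lemma letter_comb_vec: "k \<in> A \<Longrightarrow> letter_comb A (letter_vec k) = mon [k]"
  by (auto simp: fun_eq_iff letter_comb_def mon_def letter_vec_def split: list.splits)

lemma letter_comb_add: "letter_comb A (x + y) = letter_comb A x + letter_comb A y"
  by (auto simp: fun_eq_iff letter_comb_def fun_apply split: list.splits)

text \<open>\<open>G\<close> is the grading operator, and \<open>W\<close> the submodule on which the Clifford relations hold.\<close>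

locale clifford_rep = word_action scale X
  for scale :: "'r::comm_ring_1 \<Rightarrow> 'w::ab_group_add \<Rightarrow> 'w" and X :: "'l \<Rightarrow> 'w \<Rightarrow> 'w" +
  fixes A :: "'l set" and Q :: "('l \<Rightarrow> 'r) \<Rightarrow> 'r" and W :: "'w set" and G :: "'w \<Rightarrow> 'w"
  assumes finite_A: "finite A"
    and subspace_W: "subspace W"
    and X_closed: "l \<in> A \<Longrightarrow> w \<in> W \<Longrightarrow> X l w \<in> W"
    and G_closed: "w \<in> W \<Longrightarrow> G w \<in> W"
    and G_add: "G (x + y) = G x + G y"
    and G_scale: "G (scale c x) = scale c (G x)"
    and G_G: "w \<in> W \<Longrightarrow> G (G w) = w"
    and G_X: "l \<in> A \<Longrightarrow> w \<in> W \<Longrightarrow> G (X l w) = - X l (G w)"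
    and faithful: "(\<And>w. w \<in> W \<Longrightarrow> scale c w = 0) \<Longrightarrow> c = 0"
    and W_square: "w \<in> W \<Longrightarrow> (\<Sum>k\<in>A. \<Sum>l\<in>A. scale (a k * a l) (X k (X l w))) = scale (Q a) w"
    and nondeg: "(\<And>k. k \<in> A \<Longrightarrow>
        (\<Sum>l\<in>A. (Q (letter_vec k + letter_vec l) - Q (letter_vec k) - Q (letter_vec l)) * a l) = 0)
      \<Longrightarrow> l \<in> A \<Longrightarrow> a l = 0"
begin

text \<open>The Gram matrix of the polar form on the letters. Assumption \<open>nondeg\<close> says
  that its kernel is zero, which over a ring does not make it invertible.\<close>

definition b :: "'l \<Rightarrow> 'l \<Rightarrow> 'r" where
  "b k l = Q (letter_vec k + letter_vec l) - Q (letter_vec k) - Q (letter_vec l)"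

definition I :: "('l,'r) falg set" where
  "I = fa_ideal A (range (cliff_rel A Q))"

lemma additive_G: "additive G"
  by (simp add: additive_def G_add)

lemma op_closed: "set u \<subseteq> A \<Longrightarrow> w \<in> W \<Longrightarrow> op u w \<in> W"
  by (induction u) (auto simp: X_closed)

lemma ev_letter_comb: "ev (letter_comb A x) w = (\<Sum>l\<in>A. scale (x l) (X l w))"
proof -
  have "ev (letter_comb A x) w
      = (\<Sum>u\<in>(\<lambda>l. [l]) ` A. scale (letter_comb A x u) (op u w))"
    using finite_A by (intro ev_superset) (auto simp: letter_comb_def split: list.splits)
  also have "\<dots> = (\<Sum>l\<in>A. scale (x l) (X l w))"
    by (subst sum.reindex) (auto simp: inj_on_def letter_comb_def intro!: sum.cong)
  finally show ?thesis .
qed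

lemma cliff_rel_in_free_alg: "cliff_rel A Q x \<in> free_alg A"
  unfolding cliff_rel_def fa_diff_eq
  by (intro free_alg_diff free_alg_mult free_alg_smult letter_comb_in_free_alg finite_A)
    (simp add: fa_one_mon mon_in_free_alg)

lemma I_subset: "I \<subseteq> free_alg A"
  unfolding I_def using cliff_rel_in_free_alg by (intro fa_ideal_subset_free_alg) auto

lemma ev_cliff_rel:
  assumes "w \<in> W"
  shows "ev (cliff_rel A Q x) w = 0"
proof -
  note comb = letter_comb_in_free_alg[OF finite_A, of x]
  have one: "fa_one \<in> free_alg A" by (simp add: fa_one_mon mon_in_free_alg)
  have "ev (cliff_rel A Q x) w = ev (letter_comb A x) (ev (letter_comb A x) w) - scale (Q x) w"
    unfolding cliff_rel_def fa_diff_eq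
      ev_diff[OF free_alg_mult[OF comb comb] free_alg_smult[OF one]] ev_mult[OF comb comb] ev_smult[OF one]
    by (simp add: fa_one_mon ev_mon)
  also have "ev (letter_comb A x) (ev (letter_comb A x) w)
      = (\<Sum>k\<in>A. \<Sum>l\<in>A. scale (x k * x l) (X k (X l w)))"
    by (simp add: ev_letter_comb X_sum X_scale scale_sum_right)
  finally show ?thesis using assms by (simp add: W_square)
qed

lemma rel_square: "k \<in> A \<Longrightarrow> mon [k,k] - fa_smult (Q (letter_vec k)) (mon []) \<in> I"
proof -
  assume "k \<in> A"
  then have "cliff_rel A Q (letter_vec k) = mon [k,k] - fa_smult (Q (letter_vec k)) (mon [])"
    by (simp add: cliff_rel_def letter_comb_vec fa_diff_eq fa_mult_mon fa_one_mon)
  then show ?thesis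
    unfolding I_def by (metis fa_ideal.gen rangeI)
qed

text \<open>Polarisation: the relation of the sum of two letters minus the relations of
  each.\<close>

lemma rel_anticomm:
  assumes "k \<in> A" "l \<in> A"
  shows "mon [k,l] + mon [l,k] - fa_smult (b k l) (mon []) \<in> I"
proof -
  have "cliff_rel A Q (letter_vec k + letter_vec l) - cliff_rel A Q (letter_vec k)
      - cliff_rel A Q (letter_vec l) = mon [k,l] + mon [l,k] - fa_smult (b k l) (mon [])"
    using assms
    by (simp add: cliff_rel_def letter_comb_vec letter_comb_add fa_diff_eq fa_mult_mon fa_one_mon
        fa_mult_add_left fa_mult_add_right b_def falg.scale_left_diff_distrib algebra_simps)
  moreover have "cliff_rel A Q x \<in> I" for x
    unfolding I_def by (auto intro: fa_ideal.gen)
  ultimately show ?thesis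
    unfolding I_def by (metis fa_ideal_diff)
qed

lemma X_anticommute:
  assumes "k \<in> A" "l \<in> A" "w \<in> W"
  shows "X k (X l w) + X l (X k w) = scale (b k l) w"
proof -
  have *: "(\<Sum>i\<in>A. \<Sum>j\<in>A. scale (x i * x j) (X i (X j w)))
      = ev (letter_comb A x) (ev (letter_comb A x) w)" for x
    by (simp add: ev_letter_comb X_sum X_scale scale_sum_right)
  have sq: "ev (letter_comb A x) (ev (letter_comb A x) w) = scale (Q x) w" for x
    using W_square[OF assms(3), of x] unfolding * .
  have letter: "ev (letter_comb A (letter_vec i)) z = X i z" if "i \<in> A" for i z
    using that by (simp add: letter_comb_vec ev_mon)
  have sum: "ev (letter_comb A (letter_vec k + letter_vec l)) z = X k z + X l z" for z
    unfolding letter_comb_add using assms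
    by (subst ev_add[of _ A]) (simp_all add: letter letter_comb_in_free_alg finite_A)
  show ?thesis
    using sq[of "letter_vec k + letter_vec l"] sq[of "letter_vec k"] sq[of "letter_vec l"] assms
    unfolding b_def sum letter[OF assms(1)] letter[OF assms(2)]
    by (simp add: X_add scale_left_diff_distrib algebra_simps)
qed

text \<open>The vector is generalised in the induction because right multiplication by
  \<open>r\<close> moves \<open>w\<close> to \<open>ev r w\<close>, which stays in
  \<open>W\<close>.\<close>

lemma ev_ideal:
  assumes "p \<in> I" "w \<in> W"
  shows "ev p w = 0"
  using assms unfolding I_def
proof (induction arbitrary: w)
  case (gen s)
  then show ?case by (auto simp: ev_cliff_rel)
next
  case zero
  then show ?case using ev_zero by (simp add: zero_fun_def)
next
  case (add p r)
  then show ?case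
    using ev_add[of p A r w] I_subset unfolding I_def fa_add_eq by auto
next
  case (lmul p r)
  then have "ev (fa_mult r p) w = ev r 0"
    using ev_mult[of r A p w] I_subset unfolding I_def by auto
  moreover have "op u 0 = 0" for u
    using op_scale[of u 0 0] by simp
  ultimately show ?case
    by (simp add: ev_def)
next
  case (rmul p r)
  have "ev r w \<in> W"
    unfolding ev_def using rmul
    by (intro subspace_sum[OF subspace_W] subspace_scale[OF subspace_W] op_closed) (auto simp: free_alg_def)
  then show ?case
    using rmul ev_mult[of p A r w] I_subset unfolding I_def by auto
qed

text \<open>The graded commutator with the odd operator \<open>X k\<close>. It is an antiderivation
  on words, and the Clifford relations make its value on a letter \<open>x\<close> the scalar
  \<open>b k x\<close>.\<close>

definition supercomm :: "'l \<Rightarrow> 'l list \<Rightarrow> 'w \<Rightarrow> 'w" where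
  "supercomm k u w = X k (op u w) - scale ((-1) ^ length u) (op u (X k w))"

lemma supercomm_Nil: "supercomm k [] w = 0"
  by (simp add: supercomm_def)

lemma supercomm_Cons:
  assumes "k \<in> A" "x \<in> A" "set u \<subseteq> A" "w \<in> W"
  shows "supercomm k (x # u) w = scale (b k x) (op u w) - X x (supercomm k u w)"
proof -
  have "X k (X x (op u w)) = scale (b k x) (op u w) - X x (X k (op u w))"
    using X_anticommute[OF assms(1,2) op_closed[OF assms(3,4)]] by (simp add: eq_diff_eq)
  then show ?thesis
    by (simp add: supercomm_def X_diff X_scale)
qed

text \<open>Conjugation by \<open>G\<close> changes the sign of each letter, so the sign in
  \<open>supercomm\<close> can be produced by operators without splitting a sum by the parity of its
  words.\<close>

lemma grading_op:
  assumes "set u \<subseteq> A" "w \<in> W"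
  shows "G (op u (G w)) = scale ((-1) ^ length u) (op u w)"
  using assms(1)
proof (induction u)
  case Nil
  then show ?case by (simp add: G_G assms)
next
  case (Cons x u)
  then have "G (X x (op u (G w))) = - X x (G (op u (G w)))"
    by (intro G_X op_closed G_closed assms) auto
  with Cons show ?case
    by (simp add: X_scale)
qed

text \<open>Iterating the Leibniz rule gives one term for each letter that is struck out. What
  remains of an ordered word is again ordered, so collecting terms yields a combination of the same
  words, with contracted coefficients weighted by row \<open>k\<close> of the Gram matrix.\<close>

lemma sum_supercomm:
  assumes "distinct ls" "set ls \<subseteq> A" "k \<in> A" "w \<in> W"
  shows "(\<Sum>u\<in>ordered_words ls. scale (c u) (supercomm k u w))
    = (\<Sum>u\<in>ordered_words ls. scale (\<Sum>l\<in>set ls. b k l * contract ls l c u) (op u w))"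
  using assms(1,2)
proof (induction ls arbitrary: c)
  case Nil
  then show ?case by (simp add: supercomm_Nil)
next
  case (Cons x xs)
  let ?S = "ordered_words xs" and ?c = "\<lambda>u. c (x # u)"
  have x: "x \<notin> set xs" "x \<in> A" and xs: "distinct xs" "set xs \<subseteq> A" using Cons.prems by auto
  have words: "set u \<subseteq> A" if "u \<in> ?S" for u
    using that set_ordered_word xs by blast
  \<comment> \<open>A word beginning with \<open>x\<close> arises only when \<open>x\<close>
    survives, hence from the negative term of the Leibniz rule.\<close>
  have head: "(\<Sum>l\<in>set (x # xs). b k l * contract (x # xs) l c (x # u))
      = - (\<Sum>l\<in>set xs. b k l * contract xs l ?c u)" for u
    using x by (simp add: contract_outside sum_negf)
  \<comment> \<open>A word without \<open>x\<close> arises either by striking \<open>x\<close> out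
    of \<open>x # u\<close> or by contracting a word that never contained it.\<close>
  have tail: "(\<Sum>l\<in>set (x # xs). b k l * contract (x # xs) l c u)
      = b k x * c (x # u) + (\<Sum>l\<in>set xs. b k l * contract xs l c u)" if "u \<in> ?S" for u
  proof -
    have "(\<Sum>l\<in>set xs. b k l * contract (x # xs) l c u) = (\<Sum>l\<in>set xs. b k l * contract xs l c u)"
      using x hd_ordered_word[OF that x(1)] by (intro sum.cong) auto
    moreover have "contract (x # xs) x c u = c (x # u)"
      using hd_ordered_word[OF that x(1)] by auto
    ultimately show ?thesis
      using x by (simp del: contract.simps)
  qed
  have "(\<Sum>u\<in>ordered_words (x # xs). scale (c u) (supercomm k u w))
      = (\<Sum>u\<in>?S. scale (?c u) (supercomm k (x # u) w)) + (\<Sum>u\<in>?S. scale (c u) (supercomm k u w))"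
    using x by (simp add: sum_ordered_words_Cons)
  also have "(\<Sum>u\<in>?S. scale (?c u) (supercomm k (x # u) w))
      = (\<Sum>u\<in>?S. scale (b k x * ?c u) (op u w)) - X x (\<Sum>u\<in>?S. scale (?c u) (supercomm k u w))"
    unfolding X_sum sum_subtractf[symmetric]
    by (intro sum.cong refl)
      (simp add: supercomm_Cons assms x words scale_right_diff_distrib X_scale mult.commute)
  also have "X x (\<Sum>u\<in>?S. scale (?c u) (supercomm k u w))
      = (\<Sum>u\<in>?S. scale (\<Sum>l\<in>set xs. b k l * contract xs l ?c u) (op (x # u) w))"
    unfolding Cons.IH[OF xs] X_sum by (simp add: X_scale)
  also have "(\<Sum>u\<in>?S. scale (b k x * ?c u) (op u w))
      - (\<Sum>u\<in>?S. scale (\<Sum>l\<in>set xs. b k l * contract xs l ?c u) (op (x # u) w))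
      + (\<Sum>u\<in>?S. scale (c u) (supercomm k u w))
    = (\<Sum>u\<in>?S. scale (\<Sum>l\<in>set (x # xs). b k l * contract (x # xs) l c (x # u)) (op (x # u) w))
      + (\<Sum>u\<in>?S. scale (\<Sum>l\<in>set (x # xs). b k l * contract (x # xs) l c u) (op u w))"
    unfolding Cons.IH[OF xs] head
    by (simp only: tail cong: sum.cong) (simp add: scale_left_distrib sum.distrib sum_negf)
  also have "\<dots> = (\<Sum>u\<in>ordered_words (x # xs).
      scale (\<Sum>l\<in>set (x # xs). b k l * contract (x # xs) l c u) (op u w))"
    by (rule sum_ordered_words_Cons[OF x(1), symmetric])
  finally show ?case .
qed

lemma ordered_words_independent:
  assumes "distinct ls" "set ls = A"
    and "\<And>w. w \<in> W \<Longrightarrow> (\<Sum>u\<in>ordered_words ls. scale (c u) (op u w)) = 0"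
    and "u \<in> ordered_words ls"
  shows "c u = 0"
proof -
  \<comment> \<open>Induction on the degree with \<open>c\<close> arbitrary, because the induction
    hypothesis is applied to contracted coefficients.\<close>
  have deg: "\<forall>u\<in>ordered_words ls. c u = 0"
    if "\<And>u. length u \<ge> r \<Longrightarrow> c u = 0"
      "\<And>w. w \<in> W \<Longrightarrow> (\<Sum>u\<in>ordered_words ls. scale (c u) (op u w)) = 0" for r c
    using that
  proof (induction r arbitrary: c)
    case 0
    then show ?case by simp
  next
    case (Suc r)
    let ?S = "ordered_words ls"
    have words: "set u \<subseteq> A" if "u \<in> ?S" for u
      using that set_ordered_word assms(2) by blast
    have sc: "(\<Sum>u\<in>?S. scale (c u) (supercomm k u w)) = 0" if k: "k \<in> A" "w \<in> W" for k w
    proof -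
      have "X k (\<Sum>u\<in>?S. scale (c u) (op u w)) = 0"
        using Suc.prems(2) k by (simp add: X_zero)
      \<comment> \<open>The relation is evaluated at G (X k w), not at X k w: applying
        \<open>G\<close> outside as well then supplies exactly the signs (-1)^|u|.\<close>
      moreover have "G (\<Sum>u\<in>?S. scale (c u) (op u (G (X k w)))) = 0"
        using Suc.prems(2) k by (simp add: G_closed X_closed additive.zero[OF additive_G])
      then have "(\<Sum>u\<in>?S. scale (c u) (scale ((-1) ^ length u) (op u (X k w)))) = 0"
        using k words by (simp add: additive.sum[OF additive_G] G_scale grading_op X_closed del: scale_scale)
      ultimately show ?thesis
        by (simp add: supercomm_def scale_right_diff_distrib sum_subtractf X_sum X_scale)
    qed
    have "\<forall>u\<in>?S. (\<Sum>l\<in>A. b k l * contract ls l c u) = 0" if k: "k \<in> A" for k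
    proof (rule Suc.IH)
      fix u :: "'l list" assume "r \<le> length u"
      then show "(\<Sum>l\<in>A. b k l * contract ls l c u) = 0"
        by (simp add: contract_degree[OF Suc.prems(1)])
    next
      fix w assume "w \<in> W"
      then show "(\<Sum>u\<in>?S. scale (\<Sum>l\<in>A. b k l * contract ls l c u) (op u w)) = 0"
        using sum_supercomm[of ls k w c] sc[OF k] assms k by simp
    qed
    \<comment> \<open>For a fixed word \<open>u\<close>, the equations for all \<open>k\<close> say
      that the vector of its contracted coefficients lies in the kernel of the Gram matrix.\<close>
    then have con: "contract ls l c u = 0" if "l \<in> set ls" "u \<in> ?S" for l u
      using nondeg[of "\<lambda>l. contract ls l c u" l] that assms(2) unfolding b_def by simp
    have nonempty: "c u = 0" if "u \<in> ?S" "u \<noteq> []" for u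
      using contract_eq_0_imp[OF assms(1) con] that by blast
    have "scale (c []) w = 0" if "w \<in> W" for w
    proof -
      have "(\<Sum>u\<in>?S. scale (c u) (op u w)) = (\<Sum>u\<in>{[]}. scale (c u) (op u w))"
        using nonempty by (intro sum.mono_neutral_right) auto
      then show ?thesis
        using Suc.prems(2)[OF that] by simp
    qed
    then have "c [] = 0" by (rule faithful)
    then show ?case using nonempty by blast
  qed
  \<comment> \<open>Off the ordered words \<open>c\<close> is arbitrary and may have unbounded
    degree; cutting it off there provides the starting bound.\<close>
  define c' where "c' = (\<lambda>u. if u \<in> ordered_words ls then c u else 0)"
  define r where "r = Suc (Max (length ` ordered_words ls))"
  have "c' u = 0" if "length u \<ge> r" for u
  proof -
    have "u \<notin> ordered_words ls"
      using that Max_ge[of "length ` ordered_words ls" "length u"] unfolding r_def by fastforce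
    then show ?thesis by (simp add: c'_def)
  qed
  moreover have "(\<Sum>u\<in>ordered_words ls. scale (c' u) (op u w)) = 0" if "w \<in> W" for w
    using assms(3)[OF that] by (simp add: c'_def)
  ultimately have "c' u = 0"
    using deg assms(4) by blast
  then show ?thesis
    using assms(4) by (simp add: c'_def)
qed

section \<open>The kernel of the action and the rank of the quotient\<close>

lemma ordered_word_in_free_alg: "u \<in> ordered_words ls \<Longrightarrow> set ls \<subseteq> A \<Longrightarrow> mon u \<in> free_alg A"
  using set_ordered_word by (intro mon_in_free_alg) blast

lemma normal_form:
  assumes "p \<in> free_alg A" "set ls = A"
  obtains r where "\<And>u. u \<notin> ordered_words ls \<Longrightarrow> r u = 0" "p - r \<in> I" "r \<in> free_alg A"
proof -
  have "p \<in> clred I (ordered_words ls)"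
    unfolding I_def
    by (rule clred_free_alg[where Q = "\<lambda>k. Q (letter_vec k)" and b = b])
      (use assms rel_square rel_anticomm in \<open>auto simp: I_def\<close>)
  then obtain r where r: "\<forall>u. u \<notin> ordered_words ls \<longrightarrow> r u = 0" "p - r \<in> I"
    unfolding clred_def by blast
  have "r = p - (p - r)" by simp
  then have "r \<in> free_alg A"
    using free_alg_diff[OF assms(1), of "p - r"] r(2) I_subset by (metis subsetD)
  with r show thesis using that by blast
qed

lemma ordered_support_kernel:
  assumes "distinct ls" "set ls = A" "\<And>u. u \<notin> ordered_words ls \<Longrightarrow> r u = 0"
    and "\<And>w. w \<in> W \<Longrightarrow> ev r w = 0"
  shows "r = 0"
proof
  fix u
  have "(\<Sum>u\<in>ordered_words ls. scale (r u) (op u w)) = 0" if "w \<in> W" for w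
    using assms(4)[OF that] ev_superset[of "ordered_words ls" r w] assms(3) by simp
  then have "r u = 0" if "u \<in> ordered_words ls"
    using ordered_words_independent[OF assms(1,2) _ that] by blast
  then show "r u = 0 u"
    using assms(3) by (auto simp: fun_apply)
qed

theorem ev_kernel: "{p \<in> free_alg A. \<forall>w\<in>W. ev p w = 0} = I"
proof (intro equalityI subsetI)
  fix p assume "p \<in> I"
  then show "p \<in> {p \<in> free_alg A. \<forall>w\<in>W. ev p w = 0}"
    using I_subset ev_ideal by auto
next
  fix p assume p: "p \<in> {p \<in> free_alg A. \<forall>w\<in>W. ev p w = 0}"
  obtain ls where ls: "set ls = A" "distinct ls"
    using finite_distinct_list[OF finite_A] by blast
  obtain r where r: "\<And>u. u \<notin> ordered_words ls \<Longrightarrow> r u = 0" "p - r \<in> I" "r \<in> free_alg A"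
    using normal_form[of p ls] p ls by blast
  have "ev r w = 0" if "w \<in> W" for w
    using ev_ideal[OF r(2) that] ev_diff[of p A r w] p r that by simp
  then have "r = 0"
    by (intro ordered_support_kernel[OF ls(2,1)] r(1))
  then show "p \<in> I" using r by simp
qed

theorem quot_free_rank: "quot_free_rank A I (2 ^ card A)"
proof -
  obtain ls where ls: "set ls = A" "distinct ls"
    using finite_distinct_list[OF finite_A] by blast
  let ?S = "ordered_words ls" and ?N = "2 ^ card A :: nat"
  have "card ?S = ?N"
    using ls card_ordered_words distinct_card by metis
  then obtain h where h: "bij_betw h {..<?N} ?S"
    using ex_bij_betw_nat_finite[of ?S] by (auto simp: atLeast0LessThan)
  \<comment> \<open>The rank predicate wants a basis numbered by naturals; \<open>h\<close> numbers
    the ordered words, and its inverse translates coefficients back.\<close>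
  have expand: "(\<lambda>v. \<Sum>k<?N. c k * mon (h k) v) = (\<lambda>v. if v \<in> ?S then c (inv_into {..<?N} h v) else 0)"
    (is "?L = ?R") for c :: "nat \<Rightarrow> 'r"
  proof
    fix v
    have "(\<Sum>k<?N. c k * mon (h k) v) = (\<Sum>u\<in>?S. c (inv_into {..<?N} h u) * mon u v)"
      using h by (subst sum.reindex_bij_betw[OF h, symmetric])
        (auto intro!: sum.cong simp: bij_betw_def inv_into_f_f)
    also have "\<dots> = (\<Sum>u\<in>?S. if u = v then c (inv_into {..<?N} h u) else 0)"
      by (intro sum.cong) (auto simp: mon_def)
    finally show "?L v = ?R v" by simp
  qed
  have "\<forall>k<?N. mon (h k) \<in> free_alg A"
    using h ls ordered_word_in_free_alg by (auto simp: bij_betw_def)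
  moreover have "\<exists>c. fa_diff p (\<lambda>v. \<Sum>k<?N. c k * mon (h k) v) \<in> I" if p: "p \<in> free_alg A" for p
  proof -
    obtain r where r: "\<And>u. u \<notin> ?S \<Longrightarrow> r u = 0" "p - r \<in> I" "r \<in> free_alg A"
      using normal_form[OF p ls(1)] by blast
    have "(\<lambda>v. \<Sum>k<?N. r (h k) * mon (h k) v) = r"
      unfolding expand[of "\<lambda>k. r (h k)"] using r(1) h
      by (auto simp: fun_eq_iff bij_betw_def f_inv_into_f)
    then have "fa_diff p (\<lambda>v. \<Sum>k<?N. r (h k) * mon (h k) v) \<in> I"
      using r(2) by (simp add: fa_diff_eq)
    then show ?thesis by (rule exI[of _ "\<lambda>k. r (h k)"])
  qed
  moreover have "\<forall>k<?N. c k = 0" if c: "(\<lambda>v. \<Sum>k<?N. c k * mon (h k) v) \<in> I" for c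
  proof (intro allI impI)
    fix k assume k: "k < ?N"
    \<comment> \<open>An element of the ideal acts by zero; being supported on ordered words, it
      vanishes identically.\<close>
    have "(\<lambda>v. if v \<in> ?S then c (inv_into {..<?N} h v) else 0) = 0"
      using c unfolding expand by (intro ordered_support_kernel[OF ls(2,1)] ev_ideal) auto
    from fun_cong[OF this, of "h k"] have "h k \<in> ?S \<Longrightarrow> c (inv_into {..<?N} h (h k)) = 0"
      by (simp only: zero_fun_apply if_True)
    moreover have "h k \<in> ?S" "inv_into {..<?N} h (h k) = k"
      using h k by (auto simp: bij_betw_def intro!: inv_into_f_f)
    ultimately show "c k = 0" by simp
  qed
  ultimately show ?thesis
    unfolding quot_free_rank_def by (intro exI[of _ "\<lambda>k. mon (h k)"]) blast
qed

end

section \<open>Octonion algebras\<close>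

interpretation vec8: module "(*s) :: 'r::comm_ring_1 \<Rightarrow> 'r^8 \<Rightarrow> 'r^8"
  by unfold_locales (simp_all add: vector_add_ldistrib vector_sadd_rdistrib vector_smult_assoc)

lemma rlinear_add: "rlinear f \<Longrightarrow> f (x + y) = f x + f y"
  and rlinear_scale: "rlinear f \<Longrightarrow> f (c *s x) = c *s f x"
  by (simp_all add: rlinear_def)

lemma rlinear_additive: "rlinear f \<Longrightarrow> additive f"
  by (simp add: additive_def rlinear_def)

lemmas rlinear_zero = additive.zero[OF rlinear_additive]
lemmas rlinear_sum = additive.sum[OF rlinear_additive]

lemma vec8_expand: "x = (\<Sum>k\<in>UNIV. x $ k *s axis k 1)" for x :: "'r::comm_ring_1^8"
proof -
  have "(\<Sum>k\<in>UNIV. x $ k *s axis k 1) $ i = (\<Sum>k\<in>UNIV. if k = i then x $ k else 0)" for i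
    unfolding sum_component by (intro sum.cong) (auto simp: axis_def)
  then show ?thesis
    by (simp add: vec_eq_iff)
qed

locale octonions =
  fixes mul :: "'r::comm_ring_1^8 \<Rightarrow> 'r^8 \<Rightarrow> 'r^8" and e :: "'r^8" and q :: "'r^8 \<Rightarrow> 'r"
  assumes oct: "octonion_algebra mul e q"
begin

lemma mul_linear: "rlinear (mul x)" "rlinear (\<lambda>x. mul x y)"
  using oct by (auto simp: octonion_algebra_def bilinear_op_def)

lemma mul_add_left: "mul (x + x') y = mul x y + mul x' y"
  and mul_scale_left: "mul (c *s x) y = c *s mul x y"
  and mul_add_right: "mul y (x + x') = mul y x + mul y x'"
  using mul_linear by (auto simp: rlinear_def)

lemma mul_diff_left: "mul (x - x') y = mul x y - mul x' y"
  using mul_add_left[of "x - x'" x' y] by (simp add: eq_diff_eq)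

lemma mul_unit [simp]: "mul e x = x" "mul x e = x"
  using oct by (auto simp: octonion_algebra_def)

lemma unit_faithful: "c *s e = 0 \<Longrightarrow> c = 0"
  using oct by (auto simp: octonion_algebra_def)

lemma q_scale: "q (c *s x) = c * c * q x"
  using oct by (auto simp: octonion_algebra_def quadratic_form_def)

lemma q_mul: "q (mul x y) = q x * q y"
  using oct by (auto simp: octonion_algebra_def)

lemma polar_commute: "polar q x y = polar q y x"
  by (simp add: polar_def add.commute)

lemma polar_add_left: "polar q (x + y) z = polar q x z + polar q y z"
  and polar_scale_left: "polar q (c *s x) z = c * polar q x z"
  using oct by (auto simp: octonion_algebra_def quadratic_form_def)

lemma polar_add_right: "polar q z (x + y) = polar q z x + polar q z y"
  and polar_scale_right: "polar q z (c *s x) = c * polar q z x"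
  using polar_add_left polar_scale_left polar_commute by metis+

lemma polar_diff_left: "polar q (x - y) z = polar q x z - polar q y z"
  using polar_add_left[of "x - y" y z] by simp

lemma polar_diff_right: "polar q z (x - y) = polar q z x - polar q z y"
  using polar_add_right[of z "x - y" y] by simp

lemma polar_zero [simp]: "polar q 0 x = 0" "polar q x 0 = 0"
  using polar_scale_left[of 0 0 x] polar_scale_right[of x 0 0] by simp_all

lemma q_add: "q (x + y) = q x + q y + polar q x y"
  by (simp add: polar_def)

lemma polar_self: "polar q x x = 2 * q x"
  using q_scale[of 2 x] q_add[of x x] vec8.scale_left_distrib[of 1 1 x] by simp

lemma nondegenerate_eq:
  assumes "\<And>z. polar q x z = polar q y z"
  shows "x = y"
proof -
  have "\<forall>z. polar q (x - y) z = 0"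
    using assms by (simp add: polar_diff_left)
  then have "x - y = 0"
    using oct unfolding octonion_algebra_def nondegenerate_def by blast
  then show ?thesis by simp
qed

text \<open>Multiplicativity at \<open>e\<close> shows that q(e) - 1 annihilates all values of
  \<open>q\<close>, hence all values of the polar form. So (q(e) - 1)e lies in the radical, and
  \<open>R\<close> embeds into O.\<close>

lemma q_unit: "q e = 1"
proof -
  have "(q e - 1) * q x = 0" for x
    using q_mul[of e x] by (simp add: algebra_simps)
  then have "polar q ((q e - 1) *s e) z = polar q 0 z" for z
    unfolding polar_scale_left polar_zero by (simp add: polar_def right_diff_distrib)
  then have "(q e - 1) *s e = 0" by (rule nondegenerate_eq)
  then show ?thesis using unit_faithful by fastforce
qed

lemma polar_mul_left: "polar q (mul x y) (mul x z) = q x * polar q y z"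
  by (simp add: polar_def mul_add_right[symmetric] q_mul algebra_simps)

lemma polar_mul_linearized:
  "polar q (mul x y) (mul x' z) + polar q (mul x' y) (mul x z) = polar q x x' * polar q y z"
  using polar_mul_left[of "x + x'" y z] polar_mul_left[of x y z] polar_mul_left[of x' y z]
  by (simp add: mul_add_left polar_add_left polar_add_right q_add algebra_simps)

text \<open>The case x' = e of the linearised composition law: left multiplication by the conjugate
  is the adjoint of left multiplication.\<close>

lemma polar_mul_adjoint: "polar q (mul x y) z = polar q y (mul (oconj q e x) z)"
  using polar_mul_linearized[of x y e z]
  by (simp add: oconj_def mul_diff_left mul_scale_left polar_diff_right polar_scale_right algebra_simps)

text \<open>This takes the place of associativity. Pairing the left side with \<open>z\<close> gives
  <xy, xz> = q(x)<y, z> by adjointness, and nondegeneracy removes \<open>z\<close>.\<close>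

lemma oconj_mul_mul: "mul (oconj q e x) (mul x y) = q x *s y"
proof (rule nondegenerate_eq)
  fix z
  have "polar q (mul (oconj q e x) (mul x y)) z = polar q (mul x z) (mul x y)"
    by (simp add: polar_mul_adjoint polar_commute[of _ z])
  then show "polar q (mul (oconj q e x) (mul x y)) z = polar q (q x *s y) z"
    by (simp add: polar_mul_left polar_scale_left polar_commute[of z])
qed

lemma oconj_oconj: "oconj q e (oconj q e x) = x"
proof -
  have "polar q (oconj q e x) e = polar q x e"
    by (simp add: oconj_def polar_diff_left polar_scale_left polar_self q_unit)
  then show ?thesis
    by (simp add: oconj_def)
qed

lemma q_oconj: "q (oconj q e x) = q x"
proof -
  have "q (oconj q e x) = q (polar q x e *s e + (-1) *s x)"
    by (simp add: oconj_def)
  also have "\<dots> = q x"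
    unfolding q_add polar_scale_left polar_scale_right q_scale q_unit
    by (simp add: polar_commute[of e x])
  finally show ?thesis .
qed

lemma mul_oconj_mul: "mul x (mul (oconj q e x) y) = q x *s y"
  using oconj_mul_mul[of "oconj q e x" y] by (simp add: oconj_oconj q_oconj)

lemma oconj_add_scale: "oconj q e (x + c *s y) = oconj q e x + c *s oconj q e y"
  by (simp add: oconj_def polar_add_left polar_scale_left vec8.scale_left_distrib vec8.scale_right_diff_distrib)

end

section \<open>Block matrices as operators\<close>

definition act :: "nat \<Rightarrow> 'r::comm_ring_1 bmat \<Rightarrow> (nat \<Rightarrow> 'r^8) \<Rightarrow> nat \<Rightarrow> 'r^8" where
  "act m A w = (\<lambda>i. \<Sum>j<m. A i j (w j))"

text \<open>Entrywise linearity without a size, so that one notion serves the blocks of all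
  sizes.\<close>

definition mlinear :: "'r::comm_ring_1 bmat \<Rightarrow> bool" where
  "mlinear A \<longleftrightarrow> (\<forall>i j. rlinear (A i j))"

lemma sum_lessThan_add: "(\<Sum>j<m + k. f j) = (\<Sum>j<m. f j) + (\<Sum>j<k. f (m + j :: nat))"
  for f :: "nat \<Rightarrow> 'a::comm_monoid_add"
  by (induction k) (simp_all add: add.assoc)

lemma act_block:
  "act (2 * m) (block m a B C d) w i =
    (if i < m then a *s w i + act m B (\<lambda>j. w (m + j)) i
     else if i < 2 * m then act m C w (i - m) + d *s w i else 0)"
proof -
  have split: "act (2 * m) (block m a B C d) w i =
      (\<Sum>j<m. block m a B C d i j (w j)) + (\<Sum>j<m. block m a B C d i (m + j) (w (m + j)))"
    unfolding act_def mult_2 by (rule sum_lessThan_add)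
  consider "i < m" | "m \<le> i" "i < 2 * m" | "2 * m \<le> i" by linarith
  then show ?thesis
  proof cases
    case 1
    have "(\<Sum>j<m. block m a B C d i j (w j)) = (\<Sum>j<m. if j = i then a *s w j else 0)"
      using 1 by (intro sum.cong) (auto simp: block_def escal_def ezero_def)
    then show ?thesis
      unfolding split using 1 by (simp add: act_def block_def)
  next
    case 2
    have "(\<Sum>j<m. block m a B C d i (m + j) (w (m + j))) = (\<Sum>j<m. if j = i - m then d *s w (m + j) else 0)"
      using 2 by (intro sum.cong) (auto simp: block_def escal_def ezero_def)
    also have "\<dots> = d *s w i" using 2 by (subst sum.delta) auto
    finally show ?thesis
      unfolding split using 2 by (simp add: act_def block_def)
  next
    case 3
    then show ?thesis
      unfolding split by (simp add: block_def ezero_def)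
  qed
qed

lemma act_mneg: "act m (mneg Z) w i = - act m Z w i"
  by (simp add: act_def mneg_def sum_negf)

lemma act_cong: "(\<And>j. j < m \<Longrightarrow> w j = w' j) \<Longrightarrow> act m A w = act m A w'"
  by (auto simp: act_def)

lemma act_add: "mlinear A \<Longrightarrow> act m A (w + w') = act m A w + act m A w'"
  by (simp add: act_def mlinear_def fun_eq_iff fun_apply rlinear_add sum.distrib)

lemma act_scale: "mlinear A \<Longrightarrow> act m A (\<lambda>j. c *s w j) = (\<lambda>i. c *s act m A w i)"
  by (simp add: act_def mlinear_def fun_eq_iff rlinear_scale vec8.scale_sum_right)

lemma act_combine:
  assumes "mlinear A"
  shows "act m A (\<lambda>j. c *s w j + d *s w' j) i = c *s act m A w i + d *s act m A w' i"
  using assms by (simp add: act_def mlinear_def rlinear_scale rlinear_add vec8.scale_sum_right sum.distrib)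

lemma mlinear_mneg: "mlinear Z \<Longrightarrow> mlinear (mneg Z)"
  by (simp add: mlinear_def mneg_def rlinear_def)

lemma mlinear_block: "mlinear B \<Longrightarrow> mlinear C \<Longrightarrow> mlinear (block m a B C d)"
  by (simp add: mlinear_def block_def rlinear_def escal_def ezero_def vec8.scale_right_distrib mult.commute)

lemma mat_alg_mlinear: "A \<in> mat_alg m \<Longrightarrow> mlinear A"
  unfolding mlinear_def
proof (intro allI)
  fix i j assume "A \<in> mat_alg m"
  then have "if i < m \<and> j < m then rlinear (A i j) else A i j = ezero"
    unfolding mat_alg_def by blast
  then have "rlinear (A i j) \<or> A i j = ezero"
    by presburger
  then show "rlinear (A i j)"
    by (auto simp: rlinear_def ezero_def)
qed

lemma block_outside: "i \<ge> 2 * m \<or> j \<ge> 2 * m \<Longrightarrow> block m a B C d i j = ezero"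
  by (auto simp: block_def)

section \<open>The matrices Z and their conjugates\<close>

context octonions
begin

abbreviation Z where "Z \<alpha> v t k \<equiv> fst (Zpair mul e q \<alpha> v t k)"
abbreviation Zbar where "Zbar \<alpha> v t k \<equiv> snd (Zpair mul e q \<alpha> v t k)"

lemma Z_Suc: "Z \<alpha> v t (Suc k) = block (2 ^ k) (v k) (Z \<alpha> v t k) (mneg (Zbar \<alpha> v t k)) (t k)"
  and Zbar_Suc: "Zbar \<alpha> v t (Suc k) = block (2 ^ k) (t k) (mneg (Z \<alpha> v t k)) (Zbar \<alpha> v t k) (v k)"
  by (simp_all add: Let_def)

lemma Z_linear: "mlinear (Z \<alpha> v t k)" "mlinear (Zbar \<alpha> v t k)"
proof (induction k)
  case 0
  { case 1 show ?case by (auto simp: mlinear_def mul_linear) (simp add: rlinear_def ezero_def)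
  next
    case 2 show ?case by (auto simp: mlinear_def mul_linear) (simp add: rlinear_def ezero_def) }
next
  case (Suc k)
  { case 1 show ?case unfolding Z_Suc by (intro mlinear_block mlinear_mneg Suc)
  next
    case 2 show ?case unfolding Zbar_Suc by (intro mlinear_block mlinear_mneg Suc) }
qed

text \<open>In the block product the off-diagonal terms cancel because scalars commute with linear
  maps, and each diagonal block adds the product of the two scalars to a product of smaller
  matrices. The two diagonal blocks contain the smaller matrices in opposite orders, so both orders
  go through the induction together.\<close>

lemma Z_Zbar:
  assumes "i < 2 ^ k"
  shows "act (2 ^ k) (Z \<alpha> v t k) (act (2 ^ k) (Zbar \<alpha> v t k) w) i = qV q k \<alpha> v t *s w i"
    and "act (2 ^ k) (Zbar \<alpha> v t k) (act (2 ^ k) (Z \<alpha> v t k) w) i = qV q k \<alpha> v t *s w i"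
  using assms
proof (induction k arbitrary: w i)
  case 0
  { case 1 then show ?case by (simp add: act_def qV_def mul_oconj_mul)
  next
    case 2 then show ?case by (simp add: act_def qV_def oconj_mul_mul) }
next
  case (Suc k)
  let ?m = "2 ^ k :: nat"
  let ?up = "\<lambda>w j. w (?m + j) :: 'r^8"
  have pow: "2 ^ Suc k = 2 * ?m" by simp
  \<comment> \<open>The inductive step for arbitrary \<open>Y\<close> and \<open>Yb\<close> whose
    products in both orders are the scalar \<open>c\<close>.\<close>
  have main: "act (2 * ?m) (block ?m a Y (mneg Yb) d) (act (2 * ?m) (block ?m d (mneg Y) Yb a) w) i
        = (c + a * d) *s w i" (is ?P)
    and main': "act (2 * ?m) (block ?m d (mneg Y) Yb a) (act (2 * ?m) (block ?m a Y (mneg Yb) d) w) i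
        = (c + a * d) *s w i" (is ?P')
    if i: "i < 2 * ?m" and Y: "mlinear Y" "mlinear Yb"
      and YYb: "\<And>w i. i < ?m \<Longrightarrow> act ?m Y (act ?m Yb w) i = c *s w i"
        "\<And>w i. i < ?m \<Longrightarrow> act ?m Yb (act ?m Y w) i = c *s w i"
    for a d c Y Yb i and w :: "nat \<Rightarrow> 'r^8"
  proof -
    \<comment> \<open>A matrix of half size reads only the first 2^k entries, so the image under a
      block matrix may be replaced by one of its halves.\<close>
    have low: "act ?m S (act (2 * ?m) (block ?m a' B C d') w) k
        = a' *s act ?m S w k + act ?m S (act ?m B (?up w)) k" if "mlinear S" for S a' B C d' k
    proof -
      have "act ?m S (act (2 * ?m) (block ?m a' B C d') w)
          = act ?m S (\<lambda>j. a' *s w j + 1 *s act ?m B (?up w) j)"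
        by (rule act_cong) (simp add: act_block)
      then show ?thesis
        using act_combine[OF that, of ?m a' w 1 "act ?m B (?up w)" k] by (simp only: vector_smult_lid)
    qed
    have high: "act ?m S (\<lambda>j. act (2 * ?m) (block ?m a' B C d') w (?m + j)) k
        = act ?m S (act ?m C w) k + d' *s act ?m S (?up w) k" if "mlinear S" for S a' B C d' k
    proof -
      have "act ?m S (\<lambda>j. act (2 * ?m) (block ?m a' B C d') w (?m + j))
          = act ?m S (\<lambda>j. 1 *s act ?m C w j + d' *s ?up w j)"
        by (rule act_cong) (simp add: act_block)
      then show ?thesis
        using act_combine[OF that, of ?m 1 "act ?m C w" d' "?up w" k] by (simp only: vector_smult_lid)
    qed
    have neg: "act ?m S (act ?m (mneg S') w) k = - act ?m S (act ?m S' w) k" if "mlinear S" for S S' w k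
    proof -
      have "act ?m (mneg S') w = (\<lambda>i. (-1) *s act ?m S' w i)"
        by (simp add: act_mneg fun_eq_iff)
      then show ?thesis using act_scale[OF that, of ?m "-1" "act ?m S' w"] by simp
    qed
    note simps = act_mneg low[OF Y(1)] low[OF Y(2)] high[OF Y(1)] high[OF Y(2)] neg[OF Y(1)] neg[OF Y(2)]
    consider "i < ?m" | "\<not> i < ?m" "i - ?m < ?m" "?m + (i - ?m) = i" using i by linarith
    then have "?P \<and> ?P'"
    proof cases
      case 1
      then have ?P unfolding act_block[of ?m a] simps
        by (simp add: act_block YYb act_mneg vec8.scale_right_distrib vec8.scale_right_diff_distrib
            vec8.scale_left_distrib mult.commute)
      moreover from 1 have ?P' unfolding act_block[of ?m d] simps
        by (simp add: act_block YYb act_mneg vec8.scale_right_distrib vec8.scale_right_diff_distrib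
            vec8.scale_left_distrib mult.commute)
      ultimately show ?thesis ..
    next
      case 2
      then have ?P unfolding act_block[of ?m a] simps using i
        by (simp add: act_block YYb act_mneg vec8.scale_right_distrib vec8.scale_right_diff_distrib
            vec8.scale_left_distrib mult.commute)
      moreover from 2 have ?P' unfolding act_block[of ?m d] simps using i
        by (simp add: act_block YYb act_mneg vec8.scale_right_distrib vec8.scale_right_diff_distrib
            vec8.scale_left_distrib mult.commute)
      ultimately show ?thesis ..
    qed
    then show ?P ?P' by auto
  qed
  have form: "qV q (Suc k) \<alpha> v t = qV q k \<alpha> v t + v k * t k"
    by (simp add: qV_def add.assoc)
  { case 1
    then show ?case
      unfolding Z_Suc Zbar_Suc pow form by (rule main[OF _ Z_linear Suc.IH])
  next
    case 2
    then show ?case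
      unfolding Z_Suc Zbar_Suc pow form by (rule main'[OF _ Z_linear Suc.IH]) }
qed

text \<open>One identity for x + c y carries additivity and homogeneity together, in the form that
  \<open>coordinate_expand\<close> expects.\<close>

lemma Z_add_scale:
  "Z (\<alpha> + c *s \<alpha>') (\<lambda>i. v i + c * v' i) (\<lambda>i. t i + c * t' i) k i j x
    = Z \<alpha> v t k i j x + c *s Z \<alpha>' v' t' k i j x"
  "Zbar (\<alpha> + c *s \<alpha>') (\<lambda>i. v i + c * v' i) (\<lambda>i. t i + c * t' i) k i j x
    = Zbar \<alpha> v t k i j x + c *s Zbar \<alpha>' v' t' k i j x"
proof (induction k arbitrary: i j)
  case 0
  { case 1 show ?case by (simp add: mul_add_left mul_scale_left ezero_def)
  next
    case 2 show ?case by (simp add: oconj_add_scale mul_add_left mul_scale_left ezero_def) }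
next
  case (Suc k)
  { case 1
    show ?case unfolding Z_Suc
      by (simp add: block_def mneg_def escal_def ezero_def Suc vec8.scale_left_distrib)
  next
    case 2
    show ?case unfolding Zbar_Suc
      by (simp add: block_def mneg_def escal_def ezero_def Suc vec8.scale_left_distrib) }
qed

lemma phi_gen_add_scale:
  "phi_gen mul e q n (\<alpha> + c *s \<alpha>') (\<lambda>i. v i + c * v' i) (\<lambda>i. t i + c * t' i) i j x
    = phi_gen mul e q n \<alpha> v t i j x + c *s phi_gen mul e q n \<alpha>' v' t' i j x"
  unfolding phi_gen_def by (simp add: block_def escal_def ezero_def Z_add_scale)

lemma phi_gen_linear: "mlinear (phi_gen mul e q n \<alpha> v t)"
  unfolding phi_gen_def by (intro mlinear_block Z_linear)

lemma phi_gen_mat_alg: "phi_gen mul e q n \<alpha> v t \<in> mat_alg (2 ^ (n + 1))"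
proof -
  have "phi_gen mul e q n \<alpha> v t i j = ezero" if "\<not> (i < 2 ^ (n + 1) \<and> j < 2 ^ (n + 1))" for i j
    unfolding phi_gen_def using that by (intro block_outside) (auto simp: not_less)
  then show ?thesis
    using phi_gen_linear[of n \<alpha> v t] unfolding mat_alg_def mlinear_def by auto
qed

text \<open>The square of an off-diagonal block matrix is diagonal, with the two products from
  \<open>Z_Zbar\<close> as its blocks.\<close>

lemma phi_gen_square:
  assumes "i < 2 ^ (n + 1)"
  shows "act (2 ^ (n + 1)) (phi_gen mul e q n \<alpha> v t) (act (2 ^ (n + 1)) (phi_gen mul e q n \<alpha> v t) w) i
    = qV q n \<alpha> v t *s w i"
proof -
  let ?m = "2 ^ n :: nat"
  have pow: "2 ^ (n + 1) = 2 * ?m" by simp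
  have low: "act ?m S (act (2 * ?m) (block ?m 0 B C 0) w) = act ?m S (act ?m B (\<lambda>j. w (?m + j)))" for S B C
    by (rule act_cong) (simp add: act_block)
  have high: "act ?m S (\<lambda>j. act (2 * ?m) (block ?m 0 B C 0) w (?m + j)) = act ?m S (act ?m C w)" for S B C
    by (rule act_cong) (simp add: act_block)
  have "i - ?m < ?m" using assms by simp
  then show ?thesis
    using assms unfolding phi_gen_def pow act_block[of ?m 0 _ _ 0 "act _ _ _"] low high
    by (simp add: Z_Zbar)
qed

end

section \<open>Coordinates on the quadratic space\<close>

lemma (in module) coordinate_expand:
  assumes "finite S" "\<And>x c y. f (\<lambda>l. x l + c * y l) = f x + scale c (f y)"
  shows "f (\<lambda>l. if l \<in> S then x l else 0) = (\<Sum>l\<in>S. scale (x l) (f (letter_vec l)))"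
  using assms(1)
proof (induction S rule: finite_induct)
  \<comment> \<open>At zero vectors and c = 1 the assumption reads f(0) = f(0) + f(0).\<close>
  case empty
  show ?case using assms(2)[of "\<lambda>_. 0" 1 "\<lambda>_. 0"] by simp
next
  case (insert k S)
  have "(\<lambda>l. if l \<in> insert k S then x l else 0)
      = (\<lambda>l. (if l \<in> S then x l else 0) + x k * letter_vec k l)"
    using insert.hyps by (auto simp: letter_vec_def fun_eq_iff)
  then show ?case
    unfolding \<open>(\<lambda>l. if l \<in> insert k S then x l else 0) = _\<close> assms(2) insert.IH
    using insert.hyps by (simp add: add.commute)
qed

definition oct_part :: "(8 + nat \<Rightarrow> 'r::comm_ring_1) \<Rightarrow> 'r^8" where
  "oct_part x = (\<chi> k. x (Inl k))"

text \<open>The cut at \<open>n\<close> matters: beyond it, the same formula would read coordinates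
  of the second copy of R^n.\<close>

definition hyp_left :: "nat \<Rightarrow> (8 + nat \<Rightarrow> 'r::comm_ring_1) \<Rightarrow> nat \<Rightarrow> 'r" where
  "hyp_left n x = (\<lambda>j. if j < n then x (Inr j) else 0)"

definition hyp_right :: "nat \<Rightarrow> (8 + nat \<Rightarrow> 'r::comm_ring_1) \<Rightarrow> nat \<Rightarrow> 'r" where
  "hyp_right n x = (\<lambda>j. if j < n then x (Inr (n + j)) else 0)"

definition coord_form :: "('r::comm_ring_1^8 \<Rightarrow> 'r) \<Rightarrow> nat \<Rightarrow> (8 + nat \<Rightarrow> 'r) \<Rightarrow> 'r" where
  "coord_form q n x = qV q n (oct_part x) (hyp_left n x) (hyp_right n x)"

lemma parts_add_scale:
  "oct_part (\<lambda>l. x l + c * y l) = oct_part x + c *s oct_part y"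
  "hyp_left n (\<lambda>l. x l + c * y l) = (\<lambda>j. hyp_left n x j + c * hyp_left n y j)"
  "hyp_right n (\<lambda>l. x l + c * y l) = (\<lambda>j. hyp_right n x j + c * hyp_right n y j)"
  by (auto simp: oct_part_def hyp_left_def hyp_right_def vec_eq_iff)

lemma parts_restrict:
  "oct_part (\<lambda>l. if l \<in> cl_letters n then x l else 0) = oct_part x"
  "hyp_left n (\<lambda>l. if l \<in> cl_letters n then x l else 0) = hyp_left n x"
  "hyp_right n (\<lambda>l. if l \<in> cl_letters n then x l else 0) = hyp_right n x"
  by (auto simp: oct_part_def hyp_left_def hyp_right_def cl_letters_def fun_eq_iff)

lemma finite_cl_letters [simp]: "finite (cl_letters n)"
  by (simp add: cl_letters_def)

lemma card_cl_letters: "card (cl_letters n) = 8 + 2 * n"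
  unfolding cl_letters_def
  by (subst card_Un_disjoint) (auto simp: card_image inj_on_def)

definition vscale :: "'r::comm_ring_1 \<Rightarrow> (nat \<Rightarrow> 'r^8) \<Rightarrow> nat \<Rightarrow> 'r^8" where
  "vscale c w = (\<lambda>i. c *s w i)"

text \<open>Columns of length \<open>m\<close> are encoded as functions vanishing from
  \<open>m\<close> on. Matrices of size \<open>m\<close> kill all later entries, so only on this
  submodule can their products be nonzero scalars.\<close>

definition column_space :: "nat \<Rightarrow> (nat \<Rightarrow> 'r::comm_ring_1^8) set" where
  "column_space m = {w. \<forall>i\<ge>m. w i = 0}"

text \<open>The parameter is the length of one half of the column, hence 2^n where
  \<open>column_space\<close> takes 2^(n+1).\<close>

definition grading :: "nat \<Rightarrow> (nat \<Rightarrow> 'r::comm_ring_1^8) \<Rightarrow> nat \<Rightarrow> 'r^8" where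
  "grading m w = (\<lambda>i. if i < m then w i else - w i)"

lemma act_closed: "A \<in> mat_alg m \<Longrightarrow> act m A w \<in> column_space m"
  by (auto simp: column_space_def act_def mat_alg_def ezero_def intro!: sum.neutral)

text \<open>Both \<open>iota\<close> and \<open>qV\<close> read \<open>v\<close> and
  \<open>w\<close> only below \<open>n\<close>, so a triple and a coordinate function that agree
  there give the same relation.\<close>

lemma cl_relations_eq: "cl_relations q n = range (cliff_rel (cl_letters n) (coord_form q n))"
proof -
  have rel: "fa_diff (fa_mult (iota n \<alpha> v w) (iota n \<alpha> v w)) (fa_smult (qV q n \<alpha> v w) fa_one)
      = cliff_rel (cl_letters n) (coord_form q n) x"
    if "\<alpha> = oct_part x" "\<And>j. j < n \<Longrightarrow> v j = x (Inr j)" "\<And>j. j < n \<Longrightarrow> w j = x (Inr (n + j))"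
    for \<alpha> v w x
  proof -
    have "iota n \<alpha> v w = letter_comb (cl_letters n) x"
      using that unfolding iota_def letter_comb_def cl_letters_def
      by (auto simp: fun_eq_iff oct_part_def split: list.splits sum.splits)
    moreover have "qV q n \<alpha> v w = coord_form q n x"
      using that by (simp add: coord_form_def qV_def hyp_left_def hyp_right_def)
    ultimately show ?thesis by (simp add: cliff_rel_def)
  qed
  show ?thesis
  proof (intro equalityI subsetI)
    fix p assume "p \<in> cl_relations q n"
    then obtain \<alpha> v w where p: "p = fa_diff (fa_mult (iota n \<alpha> v w) (iota n \<alpha> v w)) (fa_smult (qV q n \<alpha> v w) fa_one)"
      unfolding cl_relations_def by blast
    define x where "x = (\<lambda>l. case l of Inl k \<Rightarrow> \<alpha> $ k | Inr j \<Rightarrow> if j < n then v j else w (j - n))"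
    have "p = cliff_rel (cl_letters n) (coord_form q n) x"
      unfolding p by (rule rel) (auto simp: x_def oct_part_def)
    then show "p \<in> range (cliff_rel (cl_letters n) (coord_form q n))" by blast
  next
    fix p assume "p \<in> range (cliff_rel (cl_letters n) (coord_form q n))"
    then obtain x where p: "p = cliff_rel (cl_letters n) (coord_form q n) x" by blast
    have "p = fa_diff (fa_mult (iota n (oct_part x) (\<lambda>j. x (Inr j)) (\<lambda>j. x (Inr (n + j))))
          (iota n (oct_part x) (\<lambda>j. x (Inr j)) (\<lambda>j. x (Inr (n + j)))))
        (fa_smult (qV q n (oct_part x) (\<lambda>j. x (Inr j)) (\<lambda>j. x (Inr (n + j)))) fa_one)"
      unfolding p by (rule rel[symmetric]) auto
    then show "p \<in> cl_relations q n"
      unfolding cl_relations_def by blast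
  qed
qed

section \<open>The form in coordinates and the operators representing its Clifford relations\<close>

context octonions
begin

lemma cl_gen_letter:
  assumes "l \<in> cl_letters n"
  shows "cl_gen mul e q n l
    = phi_gen mul e q n (oct_part (letter_vec l)) (hyp_left n (letter_vec l)) (hyp_right n (letter_vec l))"
proof (cases l)
  case (Inl k)
  have "oct_part (letter_vec l) = axis k (1 :: 'r)" "hyp_left n (letter_vec l) = (\<lambda>i. 0 :: 'r)"
    "hyp_right n (letter_vec l) = (\<lambda>i. 0 :: 'r)"
    using Inl by (auto simp: oct_part_def hyp_left_def hyp_right_def letter_vec_def axis_def vec_eq_iff)
  then show ?thesis using Inl by (simp add: cl_gen_def)
next
  case (Inr j)
  then have j: "j < 2 * n" using assms by (auto simp: cl_letters_def)
  have o: "oct_part (letter_vec l) = (0 :: 'r^8)"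
    using Inr by (auto simp: oct_part_def letter_vec_def vec_eq_iff)
  show ?thesis
  proof (cases "j < n")
    case True
    then have "hyp_left n (letter_vec l) = (\<lambda>i. if i = j then 1 else 0 :: 'r)"
      "hyp_right n (letter_vec l) = (\<lambda>i. 0 :: 'r)"
      using Inr by (auto simp: hyp_left_def hyp_right_def letter_vec_def)
    then show ?thesis using Inr o True by (simp add: cl_gen_def)
  next
    case False
    then have "hyp_left n (letter_vec l) = (\<lambda>i. 0 :: 'r)"
      "hyp_right n (letter_vec l) = (\<lambda>i. if i = j - n then 1 else 0 :: 'r)"
      using Inr j by (auto simp: hyp_left_def hyp_right_def letter_vec_def fun_eq_iff)
    then show ?thesis using Inr o False by (simp add: cl_gen_def)
  qed
qed

lemma cl_gen_mat_alg: "cl_gen mul e q n l \<in> mat_alg (2 ^ (n + 1))"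
  unfolding cl_gen_def using phi_gen_mat_alg by (auto split: sum.splits)

text \<open>This connects \<open>cl_gen\<close>, which prescribes the homomorphism on basis letters,
  with the matrix of an arbitrary vector of V.\<close>

lemma phi_gen_coordinates:
  "phi_gen mul e q n (oct_part x) (hyp_left n x) (hyp_right n x) i j y
    = (\<Sum>l\<in>cl_letters n. x l *s cl_gen mul e q n l i j y)"
proof -
  define f where "f = (\<lambda>x. phi_gen mul e q n (oct_part x) (hyp_left n x) (hyp_right n x) i j y)"
  have "f (\<lambda>l. if l \<in> cl_letters n then x l else 0) = (\<Sum>l\<in>cl_letters n. x l *s f (letter_vec l))"
    by (rule vec8.coordinate_expand) (simp_all add: f_def parts_add_scale phi_gen_add_scale)
  then show ?thesis
    by (simp add: f_def parts_restrict cl_gen_letter)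
qed

definition coord_polar :: "nat \<Rightarrow> (8 + nat \<Rightarrow> 'r) \<Rightarrow> (8 + nat \<Rightarrow> 'r) \<Rightarrow> 'r" where
  "coord_polar n x y = polar q (oct_part x) (oct_part y)
    + (\<Sum>i<n. hyp_left n x i * hyp_right n y i + hyp_left n y i * hyp_right n x i)"

lemma coord_form_polar:
  "coord_form q n (x + y) - coord_form q n x - coord_form q n y = coord_polar n x y"
proof -
  have "x + y = (\<lambda>l. x l + 1 * y l)" by (simp add: fun_eq_iff fun_apply)
  then have "coord_form q n (x + y) = qV q n (oct_part x + oct_part y)
      (\<lambda>j. hyp_left n x j + hyp_left n y j) (\<lambda>j. hyp_right n x j + hyp_right n y j)"
    unfolding coord_form_def by (simp only: parts_add_scale) simp
  then show ?thesis
    by (simp add: coord_form_def coord_polar_def qV_def q_add algebra_simps sum.distrib)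
qed

lemma coord_polar_add_scale:
  "coord_polar n x (\<lambda>l. y l + c * z l) = coord_polar n x y + c * coord_polar n x z"
proof -
  have "(\<Sum>i<n. hyp_left n x i * (hyp_right n y i + c * hyp_right n z i)
        + (hyp_left n y i + c * hyp_left n z i) * hyp_right n x i)
      = (\<Sum>i<n. hyp_left n x i * hyp_right n y i + hyp_left n y i * hyp_right n x i)
        + c * (\<Sum>i<n. hyp_left n x i * hyp_right n z i + hyp_left n z i * hyp_right n x i)"
    unfolding sum_distrib_left sum.distrib[symmetric]
    by (intro sum.cong) (simp_all add: algebra_simps)
  then show ?thesis
    by (simp add: coord_polar_def parts_add_scale polar_add_right polar_scale_right distrib_left)
qed

lemma coord_polar_expand: "(\<Sum>l\<in>cl_letters n. coord_polar n x (letter_vec l) * y l) = coord_polar n x y"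
proof -
  have "module ((*) :: 'r \<Rightarrow> 'r \<Rightarrow> 'r)"
    by (rule module.intro) (simp_all add: algebra_simps)
  then have "coord_polar n x (\<lambda>l. if l \<in> cl_letters n then y l else 0)
      = (\<Sum>l\<in>cl_letters n. y l * coord_polar n x (letter_vec l))"
    by (rule module.coordinate_expand) (simp_all add: coord_polar_add_scale)
  moreover have "coord_polar n x (\<lambda>l. if l \<in> cl_letters n then y l else 0) = coord_polar n x y"
    by (simp only: coord_polar_def parts_restrict)
  ultimately show ?thesis
    by (simp only: mult.commute)
qed

text \<open>Pairing with basis vectors of O reduces to nondegeneracy of \<open>q\<close>; pairing
  with a hyperbolic basis vector reads off the coordinate of its partner.\<close>

lemma coord_polar_nondegenerate:
  assumes "\<And>k. k \<in> cl_letters n \<Longrightarrow> coord_polar n (letter_vec k) y = 0" "l \<in> cl_letters n"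
  shows "y l = 0"
proof (cases l)
  case (Inl k)
  have ax: "polar q (axis i 1) (oct_part y) = 0" for i
  proof -
    have "oct_part (letter_vec (Inl i)) = axis i (1 :: 'r)"
      by (auto simp: oct_part_def letter_vec_def axis_def vec_eq_iff)
    then show ?thesis
      using assms(1)[of "Inl i"]
      by (simp add: cl_letters_def coord_polar_def hyp_left_def hyp_right_def letter_vec_def)
  qed
  have "polar q z (oct_part y) = 0" for z
  proof -
    have "additive (\<lambda>z. polar q z (oct_part y))"
      by (simp add: additive_def polar_add_left)
    then have "polar q (\<Sum>k\<in>UNIV. z $ k *s axis k 1) (oct_part y)
        = (\<Sum>k\<in>UNIV. polar q (z $ k *s axis k 1) (oct_part y))"
      by (rule additive.sum)
    then show ?thesis
      by (simp add: vec8_expand[symmetric] polar_scale_left ax)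
  qed
  then have "oct_part y = 0"
    by (intro nondegenerate_eq) (simp add: polar_commute)
  then show ?thesis
    using Inl by (simp add: oct_part_def vec_eq_iff)
next
  case (Inr j)
  then have j: "j < 2 * n" using assms(2) by (auto simp: cl_letters_def)
  have o: "oct_part (letter_vec (Inr i)) = (0 :: 'r^8)" for i
    by (auto simp: oct_part_def letter_vec_def vec_eq_iff)
  show ?thesis
  proof (cases "j < n")
    case True
    \<comment> \<open>The partner of \<open>Inr j\<close> is \<open>Inr (n + j)\<close>; in the
      other case the roles are exchanged.\<close>
    have "coord_polar n (letter_vec (Inr (n + j))) y = (\<Sum>i<n. if i = j then y (Inr j) else 0)"
      unfolding coord_polar_def o polar_zero add_0_left using True
      by (intro sum.cong) (auto simp: hyp_left_def hyp_right_def letter_vec_def)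
    also have "\<dots> = y (Inr j)" using True by simp
    finally show ?thesis
      using assms(1)[of "Inr (n + j)"] True Inr by (simp add: cl_letters_def)
  next
    case False
    have "coord_polar n (letter_vec (Inr (j - n))) y = (\<Sum>i<n. if i = j - n then y (Inr j) else 0)"
      unfolding coord_polar_def o polar_zero add_0_left using False j
      by (intro sum.cong) (auto simp: hyp_left_def hyp_right_def letter_vec_def)
    also have "\<dots> = y (Inr j)"
      using False j by (subst sum.delta) (simp, force)
    finally show ?thesis
      using assms(1)[of "Inr (j - n)"] False j Inr by (simp add: cl_letters_def)
  qed
qed

lemma word_action_cl_gen: "word_action vscale (\<lambda>l. act (2 ^ (n + 1)) (cl_gen mul e q n l))"
proof unfold_locales
  show "act (2 ^ (n + 1)) (cl_gen mul e q n l) (x + y)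
    = act (2 ^ (n + 1)) (cl_gen mul e q n l) x + act (2 ^ (n + 1)) (cl_gen mul e q n l) y" for l x y
    by (rule act_add[OF mat_alg_mlinear[OF cl_gen_mat_alg]])
  show "act (2 ^ (n + 1)) (cl_gen mul e q n l) (vscale c x)
    = vscale c (act (2 ^ (n + 1)) (cl_gen mul e q n l) x)" for l c x
    unfolding vscale_def by (rule act_scale[OF mat_alg_mlinear[OF cl_gen_mat_alg]])
qed (auto simp: vscale_def fun_eq_iff fun_apply vec8.scale_right_distrib vec8.scale_left_distrib)

lemma clifford_rep_cl_gen:
  "clifford_rep vscale (\<lambda>l. act (2 ^ (n + 1)) (cl_gen mul e q n l)) (cl_letters n) (coord_form q n)
    (column_space (2 ^ (n + 1))) (grading (2 ^ n))"
proof -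
  let ?M = "2 ^ (n + 1) :: nat" and ?m = "2 ^ n :: nat"
  let ?X = "\<lambda>l. act ?M (cl_gen mul e q n l)"
  let ?phi = "\<lambda>x. phi_gen mul e q n (oct_part x) (hyp_left n x) (hyp_right n x)"
  interpret word_action vscale ?X by (rule word_action_cl_gen)
  have pow: "?M = 2 * ?m" by simp
  \<comment> \<open>The double sum in \<open>W_square\<close> is thereby the square of the matrix of
    a single vector.\<close>
  have comb: "act ?M (?phi x) w = (\<Sum>l\<in>cl_letters n. vscale (x l) (?X l w))" for x w
  proof
    fix i
    show "act ?M (?phi x) w i = (\<Sum>l\<in>cl_letters n. vscale (x l) (?X l w)) i"
      unfolding sum_fun_apply
      by (simp only: act_def phi_gen_coordinates vscale_def vec8.scale_sum_right) (rule sum.swap)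
  qed
  show ?thesis
  proof unfold_locales
    show "finite (cl_letters n)" by simp
    show "subspace (column_space ?M)"
      by (auto simp: subspace_def column_space_def vscale_def fun_apply)
    show "?X l w \<in> column_space ?M" for l w
      by (rule act_closed[OF cl_gen_mat_alg])
    show "grading ?m w \<in> column_space ?M" if "w \<in> column_space ?M" for w
      using that by (auto simp: column_space_def grading_def)
    show "grading ?m (x + y) = grading ?m x + grading ?m y" for x y
      by (auto simp: grading_def fun_eq_iff fun_apply)
    show "grading ?m (vscale c x) = vscale c (grading ?m x)" for c x
      by (auto simp: grading_def vscale_def fun_eq_iff)
    show "grading ?m (grading ?m w) = w" for w
      by (auto simp: grading_def fun_eq_iff)
    show "grading ?m (?X l w) = - ?X l (grading ?m w)" if "l \<in> cl_letters n" for l w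
    proof
      fix i
      \<comment> \<open>The generators are off-diagonal, so they exchange the halves on which the
        grading is 1 and -1.\<close>
      have low: "act ?m S (grading ?m w) = act ?m S w" for S
        by (rule act_cong) (simp add: grading_def)
      have high: "act ?m S (\<lambda>j. grading ?m w (?m + j)) i = - act ?m S (\<lambda>j. w (?m + j)) i"
        if "mlinear S" for S i
        using act_scale[OF that, of ?m "-1" "\<lambda>j. w (?m + j)"] by (simp add: grading_def fun_eq_iff)
      show "grading ?m (?X l w) i = (- ?X l (grading ?m w)) i"
        unfolding cl_gen_letter[OF that] phi_gen_def pow
        by (simp add: act_block grading_def[of ?m "act _ _ _"] fun_apply low high Z_linear)
    qed
    show "c = 0" if "\<And>w. w \<in> column_space ?M \<Longrightarrow> vscale c w = 0" for c :: 'r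
    proof -
      \<comment> \<open>The column with the unit of O on top tests whether a scalar is zero, since
        \<open>R\<close> embeds into O.\<close>
      have "vscale c (\<lambda>i. if i = 0 then e else 0) = 0"
        by (rule that) (auto simp: column_space_def)
      from fun_cong[OF this, of 0] have "c *s e = 0"
        by (simp add: vscale_def fun_apply)
      then show ?thesis by (rule unit_faithful)
    qed
    show "(\<Sum>k\<in>cl_letters n. \<Sum>l\<in>cl_letters n. vscale (a k * a l) (?X k (?X l w))) = vscale (coord_form q n a) w"
      if "w \<in> column_space ?M" for w a
    proof -
      have "(\<Sum>k\<in>cl_letters n. \<Sum>l\<in>cl_letters n. vscale (a k * a l) (?X k (?X l w)))
          = act ?M (?phi a) (act ?M (?phi a) w)"
        by (simp only: comb X_sum X_scale scale_sum_right scale_scale)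
      also have "\<dots> = vscale (coord_form q n a) w"
      proof
        fix i
        show "act ?M (?phi a) (act ?M (?phi a) w) i = vscale (coord_form q n a) w i"
        proof (cases "i < ?M")
          case True
          then show ?thesis
            unfolding vscale_def coord_form_def by (rule phi_gen_square)
        next
          case False
          \<comment> \<open>Beyond the size of the matrix both sides vanish, the right one because
            \<open>w\<close> lies in the column space.\<close>
          moreover have "act ?M (?phi a) (act ?M (?phi a) w) \<in> column_space ?M"
            by (rule act_closed[OF phi_gen_mat_alg])
          ultimately show ?thesis
            using that unfolding column_space_def vscale_def by auto
        qed
      qed
      finally show ?thesis .
    qed
    show "a l = 0" if "\<And>k. k \<in> cl_letters n \<Longrightarrow> (\<Sum>l\<in>cl_letters n.
        (coord_form q n (letter_vec k + letter_vec l) - coord_form q n (letter_vec k)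
          - coord_form q n (letter_vec l)) * a l) = 0" "l \<in> cl_letters n" for a l
      using that unfolding coord_form_polar coord_polar_expand
      by (rule coord_polar_nondegenerate)
  qed
qed

end

section \<open>Evaluation in the matrix algebra\<close>

lemma act_mat_one: "w \<in> column_space m \<Longrightarrow> act m (mat_one m) w = w"
proof
  fix i assume w: "w \<in> column_space m"
  have "act m (mat_one m) w i = (\<Sum>j<m. if j = i then w j else 0)"
    unfolding act_def mat_one_def by (intro sum.cong) (auto simp: ezero_def)
  then show "act m (mat_one m) w i = w i"
    using w by (auto simp: column_space_def)
qed

lemma act_mat_mult:
  assumes "A \<in> mat_alg m"
  shows "act m (mat_mult m A B) w = act m A (act m B w)"
proof
  fix i
  show "act m (mat_mult m A B) w i = act m A (act m B w) i"
  proof (cases "i < m")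
    case True
    have "rlinear (A i k)" for k
      using mat_alg_mlinear[OF assms] by (simp add: mlinear_def)
    then have "act m A (act m B w) i = (\<Sum>k<m. \<Sum>j<m. A i k (B k j (w j)))"
      by (simp add: act_def rlinear_sum)
    also have "\<dots> = (\<Sum>j<m. \<Sum>k<m. A i k (B k j (w j)))"
      by (rule sum.swap)
    finally show ?thesis
      using True by (simp add: act_def mat_mult_def)
  next
    case False
    then show ?thesis
      using assms by (simp add: act_def mat_mult_def mat_alg_def ezero_def)
  qed
qed

lemma mat_one_alg: "mat_one m \<in> mat_alg m"
  by (auto simp: mat_alg_def mat_one_def rlinear_def ezero_def)

lemma mat_mult_alg:
  assumes "A \<in> mat_alg m" "B \<in> mat_alg m"
  shows "mat_mult m A B \<in> mat_alg m"
  using mat_alg_mlinear[OF assms(1)] mat_alg_mlinear[OF assms(2)]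
  by (auto simp: mat_alg_def mat_mult_def mlinear_def rlinear_def sum.distrib vec8.scale_sum_right)

lemma word_mat_alg:
  "(\<And>l. F l \<in> mat_alg m) \<Longrightarrow> foldr (mat_mult m) (map F u) (mat_one m) \<in> mat_alg m"
  by (induction u) (simp_all add: mat_one_alg mat_mult_alg)

lemma act_word:
  assumes "\<And>l. F l \<in> mat_alg m" "w \<in> column_space m"
  shows "act m (foldr (mat_mult m) (map F u) (mat_one m)) w = foldr (\<lambda>l. act m (F l)) u w"
  by (induction u) (simp_all add: act_mat_one act_mat_mult assms)

text \<open>Carries the kernel from matrices to operators: an entrywise linear matrix of size
  \<open>m\<close> is determined by its action on columns.\<close>

lemma fa_eval_eq_mat_zero_iff:
  fixes F :: "'l \<Rightarrow> 'r::comm_ring_1 bmat"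
  assumes F: "\<And>l. F l \<in> mat_alg m" and "word_action vscale (\<lambda>l. act m (F l))"
  shows "fa_eval m F p = mat_zero \<longleftrightarrow>
    (\<forall>w\<in>column_space m. word_action.ev vscale (\<lambda>l. act m (F l)) p w = 0)"
proof -
  interpret word_action vscale "\<lambda>l. act m (F l)" by fact
  let ?M = "\<lambda>u. foldr (mat_mult m) (map F u) (mat_one m)"
  have ev: "ev p w = act m (fa_eval m F p) w" if w: "w \<in> column_space m" for w
  proof
    fix i
    have "ev p w i = (\<Sum>u\<in>{u. p u \<noteq> 0}. p u *s act m (?M u) w i)"
      by (simp add: ev_def sum_fun_apply vscale_def act_word[OF F w])
    also have "\<dots> = (\<Sum>j<m. \<Sum>u\<in>{u. p u \<noteq> 0}. p u *s ?M u i j (w j))"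
      unfolding act_def vec8.scale_sum_right by (rule sum.swap)
    finally show "ev p w i = act m (fa_eval m F p) w i"
      by (simp add: act_def fa_eval_def)
  qed
  show ?thesis
  proof
    assume "fa_eval m F p = mat_zero"
    then show "\<forall>w\<in>column_space m. ev p w = 0"
      by (simp add: ev act_def mat_zero_def ezero_def fun_eq_iff fun_apply)
  next
    assume R: "\<forall>w\<in>column_space m. ev p w = 0"
    have "fa_eval m F p i j x = 0" for i j x
    proof (cases "i < m \<and> j < m")
      case True
      \<comment> \<open>A column with the single entry \<open>x\<close> at \<open>j\<close> isolates
        the entry (i,j) applied to \<open>x\<close>.\<close>
      let ?w = "\<lambda>k. if k = j then x else 0"
      have w: "?w \<in> column_space m" using True by (auto simp: column_space_def)
      have zero: "fa_eval m F p i k 0 = 0" for k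
      proof -
        have "?M u i k 0 = 0" for u
          using mat_alg_mlinear[OF word_mat_alg[of F m u, OF F]] rlinear_zero by (auto simp: mlinear_def)
        then show ?thesis by (simp add: fa_eval_def)
      qed
      have "act m (fa_eval m F p) ?w i = (\<Sum>k<m. if k = j then fa_eval m F p i j x else 0)"
        unfolding act_def by (intro sum.cong) (auto simp: zero)
      then show ?thesis
        using fun_cong[of _ _ i, OF ev[OF w]] R w True by (simp add: fun_apply)
    next
      case False
      have "?M u i j = ezero" for u
        using word_mat_alg[of F m u, OF F] False by (auto simp: mat_alg_def)
      then show ?thesis by (simp add: fa_eval_def ezero_def)
    qed
    then show "fa_eval m F p = mat_zero"
      by (simp add: mat_zero_def ezero_def fun_eq_iff)
  qed
qed

text \<open>The factor 64 = 8 * 8 is the rank of End(O) for O of rank 8.\<close>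

lemma mat_free_rank: "mat_free_rank m (m * m * 64) TYPE('r::comm_ring_1)"
proof -
  define D where "D = ({..<m} \<times> {..<m}) \<times> (UNIV :: (8 \<times> 8) set)"
  \<comment> \<open>Matrix units on two levels: (a,b) is the position of the block, and inside it
    the t-th basis vector of O goes to the s-th.\<close>
  define E :: "(nat \<times> nat) \<times> (8 \<times> 8) \<Rightarrow> 'r bmat" where
    "E = (\<lambda>((a,b),(s,t)) i j x. if i = a \<and> j = b then x $ t *s axis s 1 else 0)"
  have fin: "finite D" by (simp add: D_def)
  have card: "card D = m * m * 64"
    by (simp add: D_def card_cartesian_product)
  then obtain h where h: "bij_betw h {..<m * m * 64} D"
    using ex_bij_betw_nat_finite[OF fin] by (auto simp: atLeast0LessThan)
  have coord: "(\<Sum>d\<in>D. c d *s E d i j (axis t 1)) $ s = (if i < m \<and> j < m then c ((i,j),(s,t)) else 0)"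
    for c i j s t
  proof -
    have "(\<Sum>d\<in>D. c d *s E d i j (axis t 1)) $ s = (\<Sum>d\<in>D. if d = ((i,j),(s,t)) then c d else 0)"
      unfolding sum_component
      by (intro sum.cong) (auto simp: E_def axis_def split: if_splits prod.splits)
    also have "\<dots> = (if ((i,j),(s,t)) \<in> D then c ((i,j),(s,t)) else 0)"
      using fin by simp
    finally show ?thesis by (simp add: D_def)
  qed
  have E_alg: "E d \<in> mat_alg m" if "d \<in> D" for d
    using that unfolding D_def mat_alg_def E_def
    by (auto simp: rlinear_def ezero_def vec8.scale_left_distrib)
  have reindex: "(\<Sum>k<m * m * 64. c (h k) *s E (h k) i j x) = (\<Sum>d\<in>D. c d *s E d i j x)" for c i j x
    by (rule sum.reindex_bij_betw[OF h])
  have "\<forall>k<m * m * 64. E (h k) \<in> mat_alg m"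
    using bij_betw_apply[OF h] E_alg by blast
  moreover have "\<exists>c. A = (\<lambda>i j x. \<Sum>k<m * m * 64. c k *s E (h k) i j x)" if A: "A \<in> mat_alg m" for A
  proof -
    define c where "c = (\<lambda>((i,j),(s,t)). A i j (axis t 1) $ s)"
    have lin: "rlinear (A i j)" for i j
      using mat_alg_mlinear[OF A] by (simp add: mlinear_def)
    have lin': "rlinear (\<lambda>x. \<Sum>d\<in>D. c d *s E d i j x)" for i j
      using mat_alg_mlinear[OF E_alg]
      by (auto simp: mlinear_def rlinear_def sum.distrib vec8.scale_right_distrib vec8.scale_sum_right
          mult.commute intro!: sum.cong)
    have "A i j x = (\<Sum>d\<in>D. c d *s E d i j x)" for i j x
    proof -
      \<comment> \<open>Both sides are linear, so it suffices to compare them on the basis of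
        O.\<close>
      have basis: "A i j (axis t 1) = (\<Sum>d\<in>D. c d *s E d i j (axis t 1))" for t
        using A unfolding vec_eq_iff coord by (auto simp: c_def mat_alg_def ezero_def)
      have "A i j (\<Sum>t\<in>UNIV. x $ t *s axis t 1)
          = (\<Sum>d\<in>D. c d *s E d i j (\<Sum>t\<in>UNIV. x $ t *s axis t 1))"
        by (simp only: rlinear_sum[OF lin] rlinear_sum[OF lin'] rlinear_scale[OF lin]
            rlinear_scale[OF lin'] basis)
      then show ?thesis by (simp only: vec8_expand[symmetric])
    qed
    then have "A = (\<lambda>i j x. \<Sum>k<m * m * 64. c (h k) *s E (h k) i j x)"
      unfolding reindex by blast
    then show ?thesis by (rule exI[of _ "\<lambda>k. c (h k)"])
  qed
  moreover have "\<forall>k<m * m * 64. c k = 0"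
    if c: "(\<lambda>i j x. \<Sum>k<m * m * 64. c k *s E (h k) i j x) = mat_zero" for c
  proof (intro allI impI)
    fix k assume k: "k < m * m * 64"
    \<comment> \<open>The coefficients are moved from indices to matrix units, where
      \<open>coord\<close> reads them off one at a time.\<close>
    define c' where "c' = (\<lambda>d. c (inv_into {..<m * m * 64} h d))"
    have c': "c' (h k) = c k" if "k < m * m * 64" for k
      using h that unfolding c'_def by (auto simp: bij_betw_def inv_into_f_f)
    obtain i j s t where d: "h k = ((i,j),(s,t))" by (metis prod.exhaust)
    have D: "h k \<in> D" using h k by (auto simp: bij_betw_def)
    have "(\<Sum>k<m * m * 64. c' (h k) *s E (h k) i j (axis t 1))
        = (\<Sum>k<m * m * 64. c k *s E (h k) i j (axis t 1))"
      by (intro sum.cong) (auto simp: c')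
    also have "\<dots> = 0"
      using fun_cong[OF fun_cong[OF fun_cong[OF c, of i], of j], of "axis t 1"]
      by (simp add: mat_zero_def ezero_def)
    finally have "(\<Sum>d\<in>D. c' d *s E d i j (axis t 1)) $ s = 0"
      unfolding reindex by simp
    then have "c' (h k) = 0"
      using D unfolding coord d by (simp add: D_def)
    then show "c k = 0" using c' k by simp
  qed
  ultimately show ?thesis
    unfolding mat_free_rank_def by (intro exI[of _ "\<lambda>k. E (h k)"]) blast
qed

theorem theorem10p1:
  fixes mul :: "'r::comm_ring_1^8 \<Rightarrow> 'r^8 \<Rightarrow> 'r^8" and e :: "'r^8" and q :: "'r^8 \<Rightarrow> 'r"
    and n :: nat
  assumes "octonion_algebra mul e q" and "n \<ge> 1"
  shows "{p \<in> free_alg (cl_letters n). fa_eval (2^(n+1)) (cl_gen mul e q n) p = mat_zero}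
           = cl_ideal q n
         \<and> (\<exists>N. quot_free_rank (cl_letters n) (cl_ideal q n) N \<and> mat_free_rank (2^(n+1)) N TYPE('r))"
proof -
  interpret octonions mul e q by unfold_locales (rule assms(1))
  let ?M = "2 ^ (n + 1) :: nat" and ?X = "\<lambda>l. act (2 ^ (n + 1)) (cl_gen mul e q n l)"
  interpret rep: clifford_rep vscale ?X "cl_letters n" "coord_form q n" "column_space ?M" "grading (2 ^ n)"
    by (rule clifford_rep_cl_gen)
  have ideal: "rep.I = cl_ideal q n"
    by (simp add: rep.I_def cl_ideal_def cl_relations_eq)
  have "fa_eval ?M (cl_gen mul e q n) p = mat_zero \<longleftrightarrow> (\<forall>w\<in>column_space ?M. rep.ev p w = 0)" for p
    by (rule fa_eval_eq_mat_zero_iff[OF cl_gen_mat_alg word_action_cl_gen])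
  \<comment> \<open>One inclusion makes the homomorphism well defined on the quotient Cl(V), the
    other makes it injective.\<close>
  then have "{p \<in> free_alg (cl_letters n). fa_eval ?M (cl_gen mul e q n) p = mat_zero} = cl_ideal q n"
    using rep.ev_kernel unfolding ideal by simp
  moreover have "quot_free_rank (cl_letters n) (cl_ideal q n) (2 ^ (8 + 2 * n))"
    using rep.quot_free_rank unfolding ideal card_cl_letters .
  \<comment> \<open>The exponents are 2(n+1) + 6 for matrices of endomorphisms and 8 + 2n for the
    number of letters.\<close>
  moreover have "?M * ?M * 64 = 2 ^ (8 + 2 * n)"
    by (simp add: power_add power_mult power_mult_distrib[symmetric])
  then have "mat_free_rank ?M (2 ^ (8 + 2 * n)) TYPE('r)"
    using mat_free_rank[where 'r = 'r, of ?M] by (simp only:)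
  ultimately show ?thesis by blast
qed

end
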